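(* Let $k\ge2$ be an integer and, for $1\le i\le k$, let $$x_{2k+1,i}(q):=\sum_{n_1,\dots,n_{k-1}\ge0}\frac{q^{N_1^2+\cdots+N_{k-1}^2+N_i+\cdots+N_{k-1}}}{(q;q)_{n_1}\cdots(q;q)_{n_{k-2}}(q;q)_{n_{k-1}}},$$ where $N_j=n_j+\cdots+n_{k-1}$ for $j\le k-1$ and $N_k=0$ (so for $i=k$ there is no linear term in the exponent). For $\mathrm{Im}\,\tau>0$, $q=e^{2\pi i\tau}$, let $$X_{2k+1}(\tau):=q^{-\frac1{24}}\Big(q^{\frac{1}{8(2k+1)}}x_{2k+1,k}(q),\,q^{\frac{3^2}{8(2k+1)}}x_{2k+1,k-1}(q),\,\dots,\,q^{\frac{(2k-1)^2}{8(2k+1)}}x_{2k+1,1}(q)\Big)^{\mathrm T}.$$ Then $$X_{2k+1}(\tau+1)=e^{-\frac{1}{12}\pi i}\,\mathrm{diag}\big(e^{\frac{1}{4(2k+1)}\pi i},e^{\frac{9}{4(2k+1)}\pi i},\dots,e^{\frac{(2k-1)^2}{4(2k+1)}\pi i}\big)X_{2k+1}(\tau),$$ $$X_{2k+1}\Big(-\frac1\tau\Big)=\frac{2}{\sqrt{2k+1}}\,A_{2k+1}\,X_{2k+1}(\tau),$$ where $A_{2k+1}=(a_{ij})$ is the $k\times k$ matrix with $a_{ij}=\cos\frac{(2i-1)(2j-1)\pi}{2(2k+1)}$. As a consequence, $X_{2k+1}(\tau)$ is a vector-valued modular function on $\mathrm{SL}(2,\mathbb Z)$.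
   Context: Notation: for rational $r$, $q^r:=e^{2\pi i r\tau}$; $(a;q)_n=\prod_{l=0}^{n-1}(1-aq^l)$, $(a;q)_\infty=\prod_{l\ge0}(1-aq^l)$, $(a_1,\dots,a_m;q)_\infty=\prod_i(a_i;q)_\infty$. By the known Andrews–Gordon identity, $x_{2k+1,i}(q)=\frac{(q^i,q^{2k+1-i},q^{2k+1};q^{2k+1})_\infty}{(q;q)_\infty}$. A (column) vector-valued function $X$ on the upper half plane is called a vector-valued modular function on a subgroup $\Gamma\subseteq \mathrm{SL}(2,\mathbb Z)$ (acting by Möbius transformations) if for every $\gamma\in\Gamma$ there is a constant complex matrix $\rho(\gamma)$ with $X(\gamma\tau)=\rho(\gamma)X(\tau)$ for all $\tau$. *)

theory Defs
  imports
    "HOL-Complex_Analysis.Complex_Analysis"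
    "Jordan_Normal_Form.Determinant"
begin

text \<open>
  Vectors and matrices are those of \<^theory>\<open>Jordan_Normal_Form.Matrix\<close>, since the dimension \<open>k\<close> is
  an ordinary natural number here. They are indexed from \<open>0\<close>, so that the entry with index \<open>j\<close>
  (\<open>j < k\<close>) is the mathematical entry number \<open>j + 1\<close>, and \<open>2 * j + 1\<close> stands for \<open>2 (j + 1) - 1\<close>.
\<close>

text \<open>\<open>q\<^sup>r = e\<^bsup>2 \<pi> i r \<tau>\<^esup>\<close>. This is not a principal power of the complex number \<open>q\<close>:
  it depends on \<open>\<tau>\<close>.\<close>

definition qpow :: "complex \<Rightarrow> real \<Rightarrow> complex" where
  "qpow \<tau> r = exp (2 * of_real pi * \<i> * of_real r * \<tau>)"

definition qpoch :: "complex \<Rightarrow> complex \<Rightarrow> nat \<Rightarrow> complex" where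
  "qpoch a q n = (\<Prod>l<n. 1 - a * q ^ l)"

text \<open>\<open>N\<^sub>j = n\<^sub>j + \<dots> + n\<^bsub>k-1\<^esub>\<close>; in particular \<open>N\<^sub>k = 0\<close>.\<close>

definition AG_N :: "nat \<Rightarrow> (nat \<Rightarrow> nat) \<Rightarrow> nat \<Rightarrow> nat" where
  "AG_N k n j = (\<Sum>l\<in>{j..<k}. n l)"

text \<open>The series \<open>x\<^bsub>2k+1,i\<^esub>(q)\<close>. The tuples \<open>(n\<^sub>1, \<dots>, n\<^bsub>k-1\<^esub>)\<close> are the
  extensional functions on \<open>{1..<k}\<close>, and the linear part of the exponent is empty for \<open>i = k\<close>.\<close>

definition AG_series :: "nat \<Rightarrow> nat \<Rightarrow> complex \<Rightarrow> complex" where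
  "AG_series k i q =
     (\<Sum>\<^sub>\<infinity>n \<in> {1..<k} \<rightarrow>\<^sub>E (UNIV :: nat set).
        q ^ ((\<Sum>j\<in>{1..<k}. (AG_N k n j)\<^sup>2) + (\<Sum>j\<in>{i..<k}. AG_N k n j))
          / (\<Prod>j\<in>{1..<k}. qpoch q q (n j)))"

definition AG_vec :: "nat \<Rightarrow> complex \<Rightarrow> complex Matrix.vec" where
  "AG_vec k \<tau> =
     qpow \<tau> (- 1 / 24) \<cdot>\<^sub>v
       Matrix.vec k (\<lambda>j. qpow \<tau> ((2 * real j + 1)\<^sup>2 / (8 * (2 * real k + 1)))
                         * AG_series k (k - j) (qpow \<tau> 1))"

definition AG_cos_mat :: "nat \<Rightarrow> complex Matrix.mat" where
  "AG_cos_mat k =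
     Matrix.mat k k (\<lambda>(i, j).
       of_real (cos ((2 * real i + 1) * (2 * real j + 1) * pi / (2 * (2 * real k + 1)))))"

definition SL2Z :: "int Matrix.mat monoid" where
  "SL2Z = \<lparr> carrier = {A \<in> carrier_mat 2 2. Determinant.det A = 1}, mult = (*), one = 1\<^sub>m 2 \<rparr>"

definition moebius_act :: "int Matrix.mat \<Rightarrow> complex \<Rightarrow> complex" where
  "moebius_act A \<tau> =
     (of_int (A $$ (0, 0)) * \<tau> + of_int (A $$ (0, 1)))
       / (of_int (A $$ (1, 0)) * \<tau> + of_int (A $$ (1, 1)))"

text \<open>No analytic condition on \<open>X\<close> (holomorphy, behaviour at the cusps) is part of the notion,
  and the matrices \<open>\<rho>(\<gamma>)\<close> need not be invertible or multiplicative in \<open>\<gamma>\<close>.\<close>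

definition vv_modular_function ::
    "nat \<Rightarrow> int Matrix.mat set \<Rightarrow> (complex \<Rightarrow> complex Matrix.vec) \<Rightarrow> bool" where
  "vv_modular_function d \<Gamma> X \<longleftrightarrow>
     subgroup \<Gamma> SL2Z \<and>
     (\<forall>\<tau>. Im \<tau> > 0 \<longrightarrow> X \<tau> \<in> carrier_vec d) \<and>
     (\<forall>\<gamma>\<in>\<Gamma>. \<exists>\<rho>\<in>carrier_mat d d. \<forall>\<tau>. Im \<tau> > 0 \<longrightarrow> X (moebius_act \<gamma> \<tau>) = \<rho> *\<^sub>v X \<tau>)"

lemma group_SL2Z: "group SL2Z"
proof (rule groupI)
  fix A assume A: "A \<in> carrier SL2Z"
  then have c: "A \<in> carrier_mat 2 2" and d: "Determinant.det A = 1"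
    by (auto simp: SL2Z_def)
  have adj: "adj_mat A \<in> carrier_mat 2 2" "adj_mat A * A = 1\<^sub>m 2"
    using adj_mat[OF c] d by auto
  have "Determinant.det (adj_mat A) * Determinant.det A = 1"
    using det_mult[OF adj(1) c] adj(2) by simp
  then have "Determinant.det (adj_mat A) = 1" using d by simp
  with adj show "\<exists>B\<in>carrier SL2Z. B \<otimes>\<^bsub>SL2Z\<^esub> A = \<one>\<^bsub>SL2Z\<^esub>"
    by (auto simp: SL2Z_def intro!: bexI[of _ "adj_mat A"])
qed (auto simp: SL2Z_def det_mult)

end

theory Submission
  imports Defs "HOL-Probability.Characteristic_Functions"
begin

text \<open>
  Iterating the two Bailey steps, starting from the unit Bailey pair, and letting the upper index tend to
  infinity expresses \<open>(q; q)\<^sub>\<infinity> x\<^bsub>2k+1,i\<^esub>(q)\<close> as a bilateral theta series (the Andrews--Gordon identity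
  in series form). Completing the square, the entry number \<open>j + 1\<close> of the vector is a quotient of two
  values of \<open>\<theta>(z, w) = \<Sum>\<^sub>n (-1)\<^sup>n e\<^bsup>-\<pi>w(n+z)\<^sup>2\<^esup>\<close>, the denominator being the case \<open>k = 1\<close>, i.e. the eta
  function by the pentagonal number theorem. For real \<open>w\<close>, Poisson summation expands \<open>\<theta>\<close> in a series over
  all integers; splitting it into residue classes modulo \<open>2k + 1\<close> and pairing \<open>j\<close> with \<open>2k - j\<close> yields the
  cosine matrix, and the powers of \<open>w\<close> cancel in the quotient. Analytic continuation extends the inversion
  formula to the upper half plane, and the Euclidean algorithm extends it to the whole modular group.
\<close>

section \<open>Bailey pairs\<close>

text \<open>Each factor q^(N_p^2) or q^(N_p^2 + N_p) of the multiple series comes from one Bailey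
  step, relative to 1 or to q respectively, so the index i at which the linear term starts decides
  where the chain changes its base. The two kinds of pairs agree while the exponent depends on j
  only through j^2 + j and a triangular number, that is, before any step relative to 1; the steps
  relative to q, which belong to the innermost indices p >= i, therefore have to come first. The
  Jacobi triple product never enters: for k = 1 the multiple series is the empty one with value 1,
  so the same chain expresses the eta function by a theta series and shows at once that the
  denominator does not vanish. The alternating sign makes \<open>theta\<close> antiperiodic in z,
  hence the frequencies in Poisson summation are m + 1/2. It also makes \<open>theta\<close> odd
  about z = 1/2, which kills the middle residue class and leaves k independent classes, as many as
  the vector has entries. Since the square roots disappear in the quotient, the analytic
  continuation needs no branch of a root.\<close>

definition inv_qpoch :: "complex \<Rightarrow> int \<Rightarrow> complex" where
  "inv_qpoch q m = (if m < 0 then 0 else 1 / qpoch q q (nat m))"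

lemma qpoch_Suc: "qpoch a q (Suc n) = qpoch a q n * (1 - a * q ^ n)"
  by (simp add: qpoch_def)

lemma qpoch_nonzero:
  assumes "norm q < 1"
  shows "qpoch q q n \<noteq> 0"
proof -
  have "1 - q * q ^ l \<noteq> 0" for l
  proof
    assume "1 - q * q ^ l = 0"
    then have "norm (q ^ Suc l) = 1" by simp
    moreover have "norm (q ^ Suc l) < 1"
      unfolding norm_power using assms by (subst power_less_one_iff) auto
    ultimately show False by simp
  qed
  then show ?thesis by (simp add: qpoch_def)
qed

lemma inv_qpoch_int: "inv_qpoch q (int n) = 1 / qpoch q q n"
  by (simp add: inv_qpoch_def)

lemma inv_qpoch_0 [simp]: "inv_qpoch q 0 = 1"
  by (simp add: inv_qpoch_def qpoch_def)

lemma inv_qpoch_neg [simp]: "m < 0 \<Longrightarrow> inv_qpoch q m = 0"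
  by (simp add: inv_qpoch_def)

lemma inv_qpoch_Suc:
  assumes "norm q < 1"
  shows "(1 - q ^ Suc n) * inv_qpoch q (int (Suc n)) = inv_qpoch q (int n)"
  using qpoch_nonzero[OF assms, of "Suc n"] qpoch_nonzero[OF assms, of n]
  unfolding inv_qpoch_int qpoch_Suc by (simp add: field_simps)

text \<open>Reading 1/(q;q)_m as 0 for m < 0 keeps the recursion valid on all integers: at m = -1
  the factor 1 - q^0 vanishes, and below that both sides are 0.\<close>

lemma inv_qpoch_step:
  assumes "norm q < 1"
  shows "inv_qpoch q m = (1 - q powi (m + 1)) * inv_qpoch q (m + 1)"
proof (cases "m \<ge> 0")
  case True
  then obtain n where "m = int n" using nonneg_int_cases by blast
  moreover have "q powi (int n + 1) = q ^ Suc n"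
    by (metis of_nat_Suc power_int_of_nat add.commute)
  ultimately show ?thesis using inv_qpoch_Suc[OF assms, of n] by (simp add: add.commute)
next
  case False
  then show ?thesis by (cases "m = -1") auto
qed

text \<open>A form of the q-Chu-Vandermonde sum. In the induction on N, with M arbitrary, the factor
  1 - q^(N+1) is split as (1 - q^t) + q^t (1 - q^(N+1-t)). Each part shortens one q-factorial; after
  a shift of t the two carry the weights q^(M+t+1) and 1 - q^(M+t+1), so together they form the sum
  for N and M + 1.\<close>

lemma q_vandermonde:
  assumes q: "norm q < 1"
  shows "(\<Sum>t\<le>N. q ^ (t * (t + M)) * inv_qpoch q (int t) * inv_qpoch q (int (N - t)) * inv_qpoch q (int (M + t)))
         = inv_qpoch q (int N) * inv_qpoch q (int (N + M))"
proof (induction N arbitrary: M)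
  case 0
  show ?case by simp
next
  case (Suc N)
  let ?b = "\<lambda>n. inv_qpoch q (int n)"
  let ?T = "\<lambda>t. q ^ (t * (t + M)) * ?b t * ?b (Suc N - t) * ?b (M + t)"
  have step: "(1 - q ^ Suc n) * ?b (Suc n) = ?b n" for n
    by (rule inv_qpoch_Suc[OF q])
  have "(1 - q ^ Suc N) * (\<Sum>t\<le>Suc N. ?T t)
      = (\<Sum>t\<le>Suc N. (1 - q ^ t) * ?T t) + (\<Sum>t\<le>Suc N. q ^ t * (1 - q ^ (Suc N - t)) * ?T t)"
    unfolding sum.distrib[symmetric] sum_distrib_left
  proof (rule sum.cong[OF refl])
    fix t assume "t \<in> {..Suc N}"
    then have "q ^ Suc N = q ^ t * q ^ (Suc N - t)"
      by (metis atMost_iff le_add_diff_inverse power_add)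
    then show "(1 - q ^ Suc N) * ?T t = (1 - q ^ t) * ?T t + q ^ t * (1 - q ^ (Suc N - t)) * ?T t"
      by (simp only:) (simp add: algebra_simps)
  qed
  also have "(\<Sum>t\<le>Suc N. (1 - q ^ t) * ?T t) = (\<Sum>t\<le>N. (1 - q ^ Suc t) * ?T (Suc t))"
    by (subst sum.atMost_Suc_shift) simp
  also have "\<dots> = (\<Sum>t\<le>N. q ^ (t * (t + Suc M)) * ?b t * ?b (N - t) * (q ^ Suc (M + t) * ?b (Suc (M + t))))"
  proof (rule sum.cong[OF refl])
    fix t
    have "(1 - q ^ Suc t) * ?T (Suc t)
        = q ^ (Suc t * (Suc t + M)) * ((1 - q ^ Suc t) * ?b (Suc t)) * ?b (N - t) * ?b (Suc (M + t))"
      by (simp add: mult_ac)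
    moreover have "q ^ (Suc t * (Suc t + M)) = q ^ (t * (t + Suc M)) * q ^ Suc (M + t)"
      by (simp only: power_add[symmetric]) (simp add: algebra_simps)
    moreover     have "q ^ (t * (t + Suc M)) * q ^ Suc (M + t) * ((1 - q ^ Suc t) * ?b (Suc t)) * ?b (N - t) * ?b (Suc (M + t))
        = q ^ (t * (t + Suc M)) * ?b t * ?b (N - t) * (q ^ Suc (M + t) * ?b (Suc (M + t)))"
      unfolding step by (simp only: mult_ac)
    ultimately show "(1 - q ^ Suc t) * ?T (Suc t)
        = q ^ (t * (t + Suc M)) * ?b t * ?b (N - t) * (q ^ Suc (M + t) * ?b (Suc (M + t)))"
      by (simp only:)
  qed
  also have "(\<Sum>t\<le>Suc N. q ^ t * (1 - q ^ (Suc N - t)) * ?T t)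
      = (\<Sum>t\<le>N. q ^ t * (1 - q ^ (Suc N - t)) * ?T t)"
    by (subst sum.atMost_Suc) simp
  also have "\<dots> = (\<Sum>t\<le>N. q ^ (t * (t + Suc M)) * ?b t * ?b (N - t) * ((1 - q ^ Suc (M + t)) * ?b (Suc (M + t))))"
  proof (rule sum.cong[OF refl])
    fix t assume "t \<in> {..N}"
    then have t: "Suc N - t = Suc (N - t)" by auto
    have "q ^ t * (1 - q ^ (Suc N - t)) * ?T t
        = (q ^ t * q ^ (t * (t + M))) * ?b t * ((1 - q ^ Suc (N - t)) * ?b (Suc (N - t))) * ?b (M + t)"
      unfolding t by (simp only: mult_ac)
    also have "q ^ t * q ^ (t * (t + M)) = q ^ (t * (t + Suc M))"
      by (simp only: power_add[symmetric]) (simp add: algebra_simps)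
    finally show "q ^ t * (1 - q ^ (Suc N - t)) * ?T t
        = q ^ (t * (t + Suc M)) * ?b t * ?b (N - t) * ((1 - q ^ Suc (M + t)) * ?b (Suc (M + t)))"
      unfolding step .
  qed
  also have "(\<Sum>t\<le>N. q ^ (t * (t + Suc M)) * ?b t * ?b (N - t) * (q ^ Suc (M + t) * ?b (Suc (M + t))))
      + (\<Sum>t\<le>N. q ^ (t * (t + Suc M)) * ?b t * ?b (N - t) * ((1 - q ^ Suc (M + t)) * ?b (Suc (M + t))))
      = (\<Sum>t\<le>N. q ^ (t * (t + Suc M)) * ?b t * ?b (N - t) * ?b (Suc M + t))"
    unfolding sum.distrib[symmetric] by (intro sum.cong refl) (simp add: algebra_simps)
  also have "\<dots> = ?b N * ?b (N + Suc M)" by (rule Suc.IH)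
  also have "\<dots> = (1 - q ^ Suc N) * (?b (Suc N) * ?b (Suc N + M))"
    unfolding step[of N, symmetric] by simp
  finally have "(1 - q ^ Suc N) * (\<Sum>t\<le>Suc N. ?T t) = (1 - q ^ Suc N) * (?b (Suc N) * ?b (Suc N + M))" .
  moreover have "1 - q ^ Suc N \<noteq> 0"
    using qpoch_nonzero[OF q, of "Suc N"] by (simp add: qpoch_Suc)
  ultimately show ?case by simp
qed

text \<open>The two kinds of Bailey pairs (relative to \<open>1\<close> and to \<open>q\<close>), with the
  \<open>\<alpha>\<close>-sequence symmetrised over all of the integers.\<close>

definition bailey :: "complex \<Rightarrow> (int \<Rightarrow> complex) \<Rightarrow> nat \<Rightarrow> complex" where
  "bailey q c n = (\<Sum>j\<in>{-int n..int n}. c j * inv_qpoch q (int n - j) * inv_qpoch q (int n + j))"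

definition bailey' :: "complex \<Rightarrow> (int \<Rightarrow> complex) \<Rightarrow> nat \<Rightarrow> complex" where
  "bailey' q c n = (\<Sum>j\<in>{-int n - 1..int n}. c j * inv_qpoch q (int n - j) * inv_qpoch q (int n + j + 1))"

text \<open>Substituting s = j + t gives \<open>q_vandermonde\<close> with N = n - j and M = 2 j +
  e. The offset e = 0 serves the pairs relative to 1 and e = 1 those relative to q. For j > n both
  sides are 0.\<close>

lemma bailey_step_aux:
  assumes q: "norm q < 1"
  shows "(\<Sum>s=j..n. q ^ ((s - j) * (s + j + e)) * inv_qpoch q (int (n - s)) * inv_qpoch q (int s - int j)
             * inv_qpoch q (int s + int j + int e))
       = inv_qpoch q (int n - int j) * inv_qpoch q (int n + int j + int e)"
proof (cases "j \<le> n")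
  case True
  have "(\<Sum>s=j..n. q ^ ((s - j) * (s + j + e)) * inv_qpoch q (int (n - s)) * inv_qpoch q (int s - int j)
             * inv_qpoch q (int s + int j + int e))
     = (\<Sum>t\<le>n - j. q ^ (t * (t + (2 * j + e))) * inv_qpoch q (int t) * inv_qpoch q (int ((n - j) - t))
             * inv_qpoch q (int ((2 * j + e) + t)))"
    by (rule sum.reindex_bij_witness[where i = "\<lambda>t. t + j" and j = "\<lambda>s. s - j"])
       (use True in \<open>auto simp: of_nat_diff algebra_simps\<close>)
  also have "\<dots> = inv_qpoch q (int (n - j)) * inv_qpoch q (int (n - j + (2 * j + e)))"
    by (rule q_vandermonde[OF q])
  finally show ?thesis using True by (simp add: of_nat_diff algebra_simps)
qed auto

text \<open>Bailey's lemma relative to 1 with both free parameters sent to infinity. After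
  exchanging the sums, s^2 = j^2 + (s - j)(s + j) splits off the factor of the new coefficient, and
  the inner sum is \<open>bailey_step_aux\<close>.\<close>

lemma bailey_step:
  assumes q: "norm q < 1"
  shows "bailey q (\<lambda>j. q ^ nat (j\<^sup>2) * c j) n
       = (\<Sum>s\<le>n. q ^ (s\<^sup>2) * inv_qpoch q (int (n - s)) * bailey q c s)"
proof -
  \<comment> \<open>A range of j common to all s permits the exchange of sums; the added terms
    contain a reciprocal at a negative index and vanish.\<close>
  have ext: "bailey q c s = (\<Sum>j\<in>{-int n..int n}. c j * inv_qpoch q (int s - j) * inv_qpoch q (int s + j))"
    if "s \<le> n" for s
    unfolding bailey_def by (rule sum.mono_neutral_left) (use that in auto)
  have inner: "(\<Sum>s\<le>n. q ^ (s\<^sup>2) * inv_qpoch q (int (n - s)) * (inv_qpoch q (int s - j) * inv_qpoch q (int s + j)))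
      = q ^ nat (j\<^sup>2) * (inv_qpoch q (int n - j) * inv_qpoch q (int n + j))" for j
  proof -
    define m where "m = nat \<bar>j\<bar>"
    have m: "inv_qpoch q (int s - j) * inv_qpoch q (int s + j)
           = inv_qpoch q (int s - int m) * inv_qpoch q (int s + int m + int 0)" for s
      by (cases "j \<ge> 0") (auto simp: m_def)
    have m2: "nat (j\<^sup>2) = m\<^sup>2"
      unfolding m_def by (metis nat_power_eq abs_ge_zero power2_abs)
    have "(\<Sum>s\<le>n. q ^ (s\<^sup>2) * inv_qpoch q (int (n - s)) * (inv_qpoch q (int s - j) * inv_qpoch q (int s + j)))
       = (\<Sum>s=m..n. q ^ (s\<^sup>2) * inv_qpoch q (int (n - s)) * (inv_qpoch q (int s - j) * inv_qpoch q (int s + j)))"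
      by (rule sum.mono_neutral_right) (auto simp: m)
    also have "\<dots> = (\<Sum>s=m..n. q ^ (m\<^sup>2) * (q ^ ((s - m) * (s + m + 0)) * inv_qpoch q (int (n - s)) * inv_qpoch q (int s - int m)
             * inv_qpoch q (int s + int m + int 0)))"
    proof (rule sum.cong[OF refl])
      fix s assume "s \<in> {m..n}"
      then obtain t where t: "s = m + t" using le_Suc_ex by auto
      have "q ^ (s\<^sup>2) = q ^ (m\<^sup>2) * q ^ ((s - m) * (s + m + 0))"
        unfolding power_add[symmetric] t by (simp add: power2_eq_square algebra_simps)
      then show "q ^ (s\<^sup>2) * inv_qpoch q (int (n - s)) * (inv_qpoch q (int s - j) * inv_qpoch q (int s + j))
        = q ^ (m\<^sup>2) * (q ^ ((s - m) * (s + m + 0)) * inv_qpoch q (int (n - s)) * inv_qpoch q (int s - int m)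
             * inv_qpoch q (int s + int m + int 0))"
        unfolding m by (simp only: mult.assoc)
    qed
    also have "\<dots> = q ^ nat (j\<^sup>2) * (inv_qpoch q (int n - j) * inv_qpoch q (int n + j))"
      unfolding sum_distrib_left[symmetric] bailey_step_aux[OF q] m2 m ..
    finally show ?thesis .
  qed
  have "(\<Sum>s\<le>n. q ^ (s\<^sup>2) * inv_qpoch q (int (n - s)) * bailey q c s)
      = (\<Sum>s\<le>n. \<Sum>j\<in>{-int n..int n}. c j * (q ^ (s\<^sup>2) * inv_qpoch q (int (n - s))
          * (inv_qpoch q (int s - j) * inv_qpoch q (int s + j))))"
    by (intro sum.cong refl) (auto simp: ext sum_distrib_left mult_ac intro!: sum.cong)
  also have "\<dots> = (\<Sum>j\<in>{-int n..int n}. c j * (q ^ nat (j\<^sup>2) * (inv_qpoch q (int n - j) * inv_qpoch q (int n + j))))"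
    by (subst sum.swap) (simp only: sum_distrib_left[symmetric] inner)
  finally show ?thesis unfolding bailey_def by (simp add: mult_ac)
qed

text \<open>Here s^2 + s = j^2 + j + (s - j)(s + j + 1), and the symmetry j -> -j is replaced by j
  -> -1 - j, whence the window from -n - 1 to n.\<close>

lemma bailey'_step:
  assumes q: "norm q < 1"
  shows "bailey' q (\<lambda>j. q ^ nat (j\<^sup>2 + j) * c j) n
       = (\<Sum>s\<le>n. q ^ (s\<^sup>2 + s) * inv_qpoch q (int (n - s)) * bailey' q c s)"
proof -
  have ext: "bailey' q c s = (\<Sum>j\<in>{-int n-1..int n}. c j * inv_qpoch q (int s - j) * inv_qpoch q (int s + j + 1))"
    if "s \<le> n" for s
    unfolding bailey'_def by (rule sum.mono_neutral_left) (use that in auto)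
  have inner: "(\<Sum>s\<le>n. q ^ (s\<^sup>2 + s) * inv_qpoch q (int (n - s)) * (inv_qpoch q (int s - j) * inv_qpoch q (int s + j + 1)))
      = q ^ nat (j\<^sup>2 + j) * (inv_qpoch q (int n - j) * inv_qpoch q (int n + j + 1))" for j
  proof -
    \<comment> \<open>The nonnegative representative of the pair j, -1 - j.\<close>
    define m where "m = nat (if j \<ge> 0 then j else - 1 - j)"
    have jm: "j = int m \<or> j = - 1 - int m" by (auto simp: m_def)
    have m: "inv_qpoch q (int s - j) * inv_qpoch q (int s + j + 1)
           = inv_qpoch q (int s - int m) * inv_qpoch q (int s + int m + int 1)" for s
    proof (cases "j = int m")
      case False
      then have "int s - j = int s + int m + 1" "int s + j + 1 = int s - int m" using jm by auto
      then show ?thesis by (simp only: mult.commute of_nat_1)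
    qed simp
    have "j\<^sup>2 + j = int (m\<^sup>2 + m)"
    proof (cases "j = int m")
      case False
      then have j: "j = - 1 - int m" using jm by auto
      show ?thesis unfolding j by (simp add: power2_eq_square algebra_simps)
    qed simp
    then have m2: "nat (j\<^sup>2 + j) = m\<^sup>2 + m" by (simp only: nat_int)
    have "(\<Sum>s\<le>n. q ^ (s\<^sup>2 + s) * inv_qpoch q (int (n - s)) * (inv_qpoch q (int s - j) * inv_qpoch q (int s + j + 1)))
       = (\<Sum>s=m..n. q ^ (s\<^sup>2 + s) * inv_qpoch q (int (n - s)) * (inv_qpoch q (int s - j) * inv_qpoch q (int s + j + 1)))"
      by (rule sum.mono_neutral_right) (auto simp: m)
    also have "\<dots> = (\<Sum>s=m..n. q ^ (m\<^sup>2 + m) * (q ^ ((s - m) * (s + m + 1)) * inv_qpoch q (int (n - s)) * inv_qpoch q (int s - int m)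
             * inv_qpoch q (int s + int m + int 1)))"
    proof (rule sum.cong[OF refl])
      fix s assume "s \<in> {m..n}"
      then obtain t where t: "s = m + t" using le_Suc_ex by auto
      have "q ^ (s\<^sup>2 + s) = q ^ (m\<^sup>2 + m) * q ^ ((s - m) * (s + m + 1))"
        unfolding power_add[symmetric] t by (simp add: power2_eq_square algebra_simps)
      then show "q ^ (s\<^sup>2 + s) * inv_qpoch q (int (n - s)) * (inv_qpoch q (int s - j) * inv_qpoch q (int s + j + 1))
        = q ^ (m\<^sup>2 + m) * (q ^ ((s - m) * (s + m + 1)) * inv_qpoch q (int (n - s)) * inv_qpoch q (int s - int m)
             * inv_qpoch q (int s + int m + int 1))"
        unfolding m by (simp only: mult.assoc)
    qed
    also have "\<dots> = q ^ nat (j\<^sup>2 + j) * (inv_qpoch q (int n - j) * inv_qpoch q (int n + j + 1))"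
      unfolding sum_distrib_left[symmetric] bailey_step_aux[OF q] m2 m ..
    finally show ?thesis .
  qed
  have "(\<Sum>s\<le>n. q ^ (s\<^sup>2 + s) * inv_qpoch q (int (n - s)) * bailey' q c s)
      = (\<Sum>s\<le>n. \<Sum>j\<in>{-int n-1..int n}. c j * (q ^ (s\<^sup>2 + s) * inv_qpoch q (int (n - s))
          * (inv_qpoch q (int s - j) * inv_qpoch q (int s + j + 1))))"
    by (intro sum.cong refl) (auto simp: ext sum_distrib_left mult_ac intro!: sum.cong)
  also have "\<dots> = (\<Sum>j\<in>{-int n-1..int n}. c j * (q ^ nat (j\<^sup>2 + j) * (inv_qpoch q (int n - j) * inv_qpoch q (int n + j + 1))))"
    by (subst sum.swap) (simp only: sum_distrib_left[symmetric] inner)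
  finally show ?thesis unfolding bailey'_def by (simp add: mult_ac)
qed

section \<open>The unit Bailey pair and the change from base q to base 1\<close>

lemma q_binomial:
  assumes q: "norm q < 1"
  shows "(\<Sum>i\<le>M. (-1) ^ i * q ^ (i * (i - 1) div 2) * x ^ i * inv_qpoch q (int i) * inv_qpoch q (int (M - i)))
         = inv_qpoch q (int M) * qpoch x q M"
proof (induction M)
  case 0
  show ?case by (simp add: qpoch_def)
next
  case (Suc M)
  let ?b = "\<lambda>n. inv_qpoch q (int n)"
  let ?a = "\<lambda>i. (-1) ^ i * q ^ (i * (i - 1) div 2) * x ^ i"
  let ?T = "\<lambda>i. ?a i * ?b i * ?b (Suc M - i)"
  have step: "(1 - q ^ Suc n) * ?b (Suc n) = ?b n" for n
    by (rule inv_qpoch_Suc[OF q])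
  \<comment> \<open>Splitting 1 - q^(M+1) = (1 - q^(M+1-i)) + q^(M+1-i) (1 - q^i) gives the sum for
    M twice, with the factors 1 and - x q^M; their sum is the new factor of (x;q)_(M+1).\<close>
  have "(1 - q ^ Suc M) * (\<Sum>i\<le>Suc M. ?T i)
      = (\<Sum>i\<le>Suc M. (1 - q ^ (Suc M - i)) * ?T i) + (\<Sum>i\<le>Suc M. q ^ (Suc M - i) * (1 - q ^ i) * ?T i)"
    unfolding sum.distrib[symmetric] sum_distrib_left
  proof (rule sum.cong[OF refl])
    fix i assume "i \<in> {..Suc M}"
    then have "q ^ Suc M = q ^ (Suc M - i) * q ^ i"
      by (metis atMost_iff le_add_diff_inverse2 power_add)
    then show "(1 - q ^ Suc M) * ?T i = (1 - q ^ (Suc M - i)) * ?T i + q ^ (Suc M - i) * (1 - q ^ i) * ?T i"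
      by (simp only:) (simp add: algebra_simps)
  qed
  also have "(\<Sum>i\<le>Suc M. (1 - q ^ (Suc M - i)) * ?T i) = (\<Sum>i\<le>M. (1 - q ^ (Suc M - i)) * ?T i)"
    by (subst sum.atMost_Suc) simp
  also have "\<dots> = (\<Sum>i\<le>M. ?a i * ?b i * ?b (M - i))"
  proof (rule sum.cong[OF refl])
    fix i assume "i \<in> {..M}"
    then have i: "Suc M - i = Suc (M - i)" by auto
    have "(1 - q ^ (Suc M - i)) * ?T i = ?a i * ?b i * ((1 - q ^ Suc (M - i)) * ?b (Suc (M - i)))"
      unfolding i by (simp only: mult_ac)
    then show "(1 - q ^ (Suc M - i)) * ?T i = ?a i * ?b i * ?b (M - i)"
      unfolding step .
  qed
  also have "(\<Sum>i\<le>Suc M. q ^ (Suc M - i) * (1 - q ^ i) * ?T i) = (\<Sum>i\<le>M. q ^ (M - i) * (1 - q ^ Suc i) * ?T (Suc i))"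
    by (subst sum.atMost_Suc_shift) simp
  also have "\<dots> = (\<Sum>i\<le>M. - (x * q ^ M) * (?a i * ?b i * ?b (M - i)))"
  proof (rule sum.cong[OF refl])
    fix i assume i: "i \<in> {..M}"
    have "q ^ (M - i) * (1 - q ^ Suc i) * ?T (Suc i)
        = - ((-1) ^ i * (q ^ (M - i) * q ^ (Suc i * (Suc i - 1) div 2)) * (x * x ^ i)
            * ((1 - q ^ Suc i) * ?b (Suc i)) * ?b (M - i))"
      by (simp add: mult_ac)
    moreover have "q ^ (M - i) * q ^ (Suc i * (Suc i - 1) div 2) = q ^ M * q ^ (i * (i - 1) div 2)"
    proof -
      have "Suc i * (Suc i - 1) div 2 = i * (i - 1) div 2 + i"
        by (cases i) (auto simp: algebra_simps)
      then have "M - i + Suc i * (Suc i - 1) div 2 = M + i * (i - 1) div 2" using i by auto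
      then show ?thesis by (metis power_add)
    qed
    ultimately have "q ^ (M - i) * (1 - q ^ Suc i) * ?T (Suc i)
        = - ((-1) ^ i * (q ^ M * q ^ (i * (i - 1) div 2)) * (x * x ^ i) * ?b i * ?b (M - i))"
      unfolding step by (simp only:)
    also have "\<dots> = - (x * q ^ M) * (?a i * ?b i * ?b (M - i))"
      by (simp only: mult_ac minus_mult_left minus_mult_right)
    finally show "q ^ (M - i) * (1 - q ^ Suc i) * ?T (Suc i)
        = - (x * q ^ M) * (?a i * ?b i * ?b (M - i))" .
  qed
  finally have "(1 - q ^ Suc M) * (\<Sum>i\<le>Suc M. ?T i)
      = (1 - x * q ^ M) * (\<Sum>i\<le>M. ?a i * ?b i * ?b (M - i))"
    unfolding sum_distrib_left[symmetric] by (simp add: algebra_simps)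
  also have "\<dots> = (1 - x * q ^ M) * (((1 - q ^ Suc M) * ?b (Suc M)) * qpoch x q M)"
    unfolding Suc.IH step ..
  also have "\<dots> = (1 - q ^ Suc M) * (?b (Suc M) * qpoch x q (Suc M))"
    by (simp add: qpoch_Suc mult_ac)
  finally have "(1 - q ^ Suc M) * (\<Sum>i\<le>Suc M. ?T i) = (1 - q ^ Suc M) * (?b (Suc M) * qpoch x q (Suc M))" .
  moreover have "1 - q ^ Suc M \<noteq> 0"
    using qpoch_nonzero[OF q, of "Suc M"] by (simp add: qpoch_Suc)
  ultimately show ?case by (simp only: mult_cancel_left simp_thms)
qed

text \<open>The \<open>\<alpha>\<close>-sequence obtained from the unit Bailey pair by \<open>a\<close> steps relative to \<open>q\<close>
  followed by \<open>b\<close> steps relative to \<open>1\<close>.\<close>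

definition bailey_coeff :: "complex \<Rightarrow> nat \<Rightarrow> nat \<Rightarrow> int \<Rightarrow> complex" where
  "bailey_coeff q a b j =
     (-1) powi j * q ^ (b * nat (j\<^sup>2) + a * nat (j\<^sup>2 + j) + nat (j * (j - 1) div 2))"

text \<open>With j = i - n - 1 this is the finite q-binomial theorem of length 2 n + 1 at x =
  q^(-n-1). For n > 0 the product (x;q)_(2n+1) reaches the factor 1 - x q^(n+1) = 0; for n = 0 it
  stops before it.\<close>

lemma bailey'_unit:
  assumes q: "norm q < 1" "q \<noteq> 0"
  shows "bailey' q (bailey_coeff q 0 0) n = (if n = 0 then 1 else 0)"
proof -
  define x where "x = inverse (q ^ (n + 1))"
  \<comment> \<open>The coefficient at the left end j = -n - 1, that is, at i = 0.\<close>
  define C where "C = (-1) ^ Suc n * q ^ ((n + 1) * (n + 2) div 2)"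
  let ?M = "2 * n + 1"
  have coeff: "bailey_coeff q 0 0 (int i - int n - 1) = C * ((-1) ^ i * q ^ (i * (i - 1) div 2) * x ^ i)" for i
  proof -
    define j where "j = int i - int n - 1"
    have "(-1::complex) powi j = (-1) powi (int i) / (-1) powi (int (Suc n))"
      unfolding j_def by (subst power_int_diff[symmetric]) (auto simp: algebra_simps)
    also have "\<dots> = (-1) ^ i * (-1) ^ Suc n"
      by (simp add: power_int_of_nat del: power_Suc) (auto simp: minus_one_power_iff)
    finally have sgn: "(-1::complex) powi j = (-1) ^ i * (-1) ^ Suc n" .
    have dj: "2 * (j * (j - 1) div 2) = j * (j - 1)" by simp
    then have "j * (j - 1) div 2 \<ge> 0"
      using mult_nonneg_nonneg[of j "j - 1"] mult_nonpos_nonpos[of j "j - 1"] by linarith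
    moreover have di: "2 * int (i * (i - 1) div 2) = int i * (int i - 1)"
    proof -
      have "2 * (i * (i - 1) div 2) = i * (i - 1)" by (cases i) auto
      then have "2 * int (i * (i - 1) div 2) = int (i * (i - 1))" by presburger
      then show ?thesis by (cases i) (auto simp: algebra_simps)
    qed
    moreover have dn: "2 * int ((n + 1) * (n + 2) div 2) = (int n + 1) * (int n + 2)"
    proof -
      have "2 * ((n + 1) * (n + 2) div 2) = (n + 1) * (n + 2)" by simp
      then have "2 * int ((n + 1) * (n + 2) div 2) = int ((n + 1) * (n + 2))" by presburger
      then show ?thesis by (simp add: algebra_simps)
    qed
    moreover have "j * (j - 1) + 2 * ((int n + 1) * int i) = int i * (int i - 1) + (int n + 1) * (int n + 2)"
      unfolding j_def by (simp add: algebra_simps)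
    ultimately have "int (nat (j * (j - 1) div 2) + (n + 1) * i)
        = int (i * (i - 1) div 2 + (n + 1) * (n + 2) div 2)"
      using dj by (simp add: algebra_simps)
    then have "nat (j * (j - 1) div 2) + (n + 1) * i = i * (i - 1) div 2 + (n + 1) * (n + 2) div 2"
      by (simp only: of_nat_eq_iff)
    then have "q ^ nat (j * (j - 1) div 2) * (q ^ (n + 1)) ^ i = q ^ (i * (i - 1) div 2) * q ^ ((n + 1) * (n + 2) div 2)"
      unfolding power_mult[symmetric] power_add[symmetric] by (simp only:)
    moreover have "(q ^ (n + 1)) ^ i * x ^ i = 1"
      unfolding x_def power_mult_distrib[symmetric] using right_inverse[of "q ^ (n + 1)"] q
      by (simp only: power_one power_not_zero not_False_eq_True simp_thms)
    ultimately have "q ^ nat (j * (j - 1) div 2) = q ^ (i * (i - 1) div 2) * q ^ ((n + 1) * (n + 2) div 2) * x ^ i"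
      by (metis mult.assoc mult.right_neutral)
    then show ?thesis unfolding bailey_coeff_def j_def[symmetric] sgn C_def by (simp add: mult_ac)
  qed
  have "bailey' q (bailey_coeff q 0 0) n
      = (\<Sum>i\<le>?M. C * ((-1) ^ i * q ^ (i * (i - 1) div 2) * x ^ i * inv_qpoch q (int i) * inv_qpoch q (int (?M - i))))"
    unfolding bailey'_def
  proof (rule sum.reindex_bij_witness[where i = "\<lambda>i. int i - int n - 1" and j = "\<lambda>j. nat (j + int n + 1)"])
    fix j assume j: "j \<in> {- int n - 1..int n}"
    define i where "i = nat (j + int n + 1)"
    have i: "j = int i - int n - 1" "i \<le> ?M" using j by (auto simp: i_def)
    have "int n - j = int (?M - i)" "int n + j + 1 = int i" using i by auto
    then show "C * ((-1) ^ nat (j + int n + 1) * q ^ (nat (j + int n + 1) * (nat (j + int n + 1) - 1) div 2) * x ^ nat (j + int n + 1)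
        * inv_qpoch q (int (nat (j + int n + 1))) * inv_qpoch q (int (?M - nat (j + int n + 1))))
      = bailey_coeff q 0 0 j * inv_qpoch q (int n - j) * inv_qpoch q (int n + j + 1)"
      unfolding i_def[symmetric] i(1) coeff by (simp add: mult_ac)
  qed auto
  also have "\<dots> = C * (inv_qpoch q (int ?M) * qpoch x q ?M)"
    unfolding sum_distrib_left[symmetric] q_binomial[OF q(1)] ..
  also have "\<dots> = (if n = 0 then 1 else 0)"
  proof (cases "n = 0")
    case True
    have "q \<noteq> 1" using q by auto
    then show ?thesis using q True by (simp add: C_def x_def inv_qpoch_def qpoch_def field_simps)
  next
    case False
    have "1 - x * q ^ (n + 1) = 0" unfolding x_def using q by (subst left_inverse) auto
    then have "qpoch x q ?M = 0" unfolding qpoch_def using False by (intro prod_zero bexI[of _ "n + 1"]) auto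
    then show ?thesis using False by simp
  qed
  finally show ?thesis .
qed

text \<open>The terms of the difference of the two sides are antisymmetric under \<open>j \<mapsto> - 1 - j\<close>.\<close>

lemma bailey_eq_bailey':
  assumes q: "norm q < 1" "q \<noteq> 0"
  shows "bailey q (bailey_coeff q a 0) n = bailey' q (bailey_coeff q a 0) n"
proof -
  let ?c = "bailey_coeff q a 0"
  let ?S = "{-int n - 1..int n}"
  \<comment> \<open>By \<open>inv_qpoch_step\<close>, 1/(q;q)_(n+j) equals 1/(q;q)_(n+j+1) times 1 -
    q^(n+j+1); \<open>h\<close> collects the part with q^(n+j+1).\<close>
  define h where "h j = ?c j * q powi (int n + j + 1) * inv_qpoch q (int n - j) * inv_qpoch q (int n + j + 1)" for j
  have "bailey q ?c n = (\<Sum>j\<in>?S. ?c j * inv_qpoch q (int n - j) * inv_qpoch q (int n + j))"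
    unfolding bailey_def by (rule sum.mono_neutral_left) auto
  also have "\<dots> = (\<Sum>j\<in>?S. ?c j * inv_qpoch q (int n - j) * inv_qpoch q (int n + j + 1) - h j)"
    by (intro sum.cong refl) (subst (2) inv_qpoch_step[OF q(1)], simp add: h_def algebra_simps)
  also have "\<dots> = bailey' q ?c n - sum h ?S"
    unfolding bailey'_def by (rule sum_subtractf)
  also have "sum h ?S = 0"
  proof -
    have anti: "h (- 1 - j) = - h j" for j
    proof -
      \<comment> \<open>The quantity j^2 + j is invariant under the reflection, and the triangular
        number grows by 2 j + 1, which the power of q in \<open>h\<close> compensates. A factor
        q^(j^2) would destroy this, hence b = 0.\<close>
      have e0: "(- 1 - j)\<^sup>2 + (- 1 - j) = j\<^sup>2 + j" by (simp add: power2_eq_square algebra_simps)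
      have nn: "m * (m - 1) div 2 \<ge> 0" for m :: int
      proof -
        have "2 * (m * (m - 1) div 2) = m * (m - 1)" by simp
        then show ?thesis
          using mult_nonneg_nonneg[of m "m - 1"] mult_nonpos_nonpos[of m "m - 1"] by linarith
      qed
      have "2 * ((- 1 - j) * (- 1 - j - 1) div 2) = 2 * (j * (j - 1) div 2 + 2 * j + 1)"
        by (simp add: algebra_simps)
      then have e1: "(- 1 - j) * (- 1 - j - 1) div 2 = j * (j - 1) div 2 + 2 * j + 1" by simp
      have pw: "q ^ nat (m * (m - 1) div 2) = q powi (m * (m - 1) div 2)" for m :: int
        using nn[of m] by (simp add: power_int_def)
      have "q ^ nat ((- 1 - j) * (- 1 - j - 1) div 2) * q powi (int n + (- 1 - j) + 1)
          = q ^ nat (j * (j - 1) div 2) * q powi (int n + j + 1)"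
        unfolding pw using q unfolding e1
        by (simp add: power_int_add[symmetric] algebra_simps)
      moreover have "(-1::complex) powi (- 1 - j) = - ((-1) powi j)"
        by (simp add: power_int_diff power_int_minus field_simps flip: power_int_add)
      moreover have "inv_qpoch q (int n - (- 1 - j)) = inv_qpoch q (int n + j + 1)"
        "inv_qpoch q (int n + (- 1 - j) + 1) = inv_qpoch q (int n - j)"
        by (simp_all add: algebra_simps)
      ultimately show ?thesis
        unfolding h_def bailey_coeff_def e0 power_add by (simp add: mult_ac)
    qed
    have "sum h ?S = (\<Sum>j\<in>?S. h (- 1 - j))"
      by (rule sum.reindex_bij_witness[where i = "\<lambda>j. - 1 - j" and j = "\<lambda>j. - 1 - j"]) auto
    also have "\<dots> = - sum h ?S" by (simp add: anti sum_negf)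
    finally show ?thesis by simp
  qed
  finally show ?thesis by simp
qed

lemma bailey'_coeff_Suc:
  assumes "norm q < 1"
  shows "bailey' q (bailey_coeff q (Suc a) 0) n
       = (\<Sum>s\<le>n. q ^ (s\<^sup>2 + s) * inv_qpoch q (int (n - s)) * bailey' q (bailey_coeff q a 0) s)"
proof -
  have "bailey_coeff q (Suc a) 0 = (\<lambda>j. q ^ nat (j\<^sup>2 + j) * bailey_coeff q a 0 j)"
    by (auto simp: bailey_coeff_def power_add mult_ac)
  then show ?thesis using bailey'_step[OF assms] by simp
qed

lemma bailey_coeff_Suc:
  assumes "norm q < 1"
  shows "bailey q (bailey_coeff q a (Suc b)) n
       = (\<Sum>s\<le>n. q ^ (s\<^sup>2) * inv_qpoch q (int (n - s)) * bailey q (bailey_coeff q a b) s)"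
proof -
  have "bailey_coeff q a (Suc b) = (\<lambda>j. q ^ nat (j\<^sup>2) * bailey_coeff q a b j)"
    by (auto simp: bailey_coeff_def power_add mult_ac)
  then show ?thesis using bailey_step[OF assms] by simp
qed

section \<open>The Andrews--Gordon series\<close>

definition AG_tuples :: "nat \<Rightarrow> nat \<Rightarrow> nat \<Rightarrow> (nat \<Rightarrow> nat) set" where
  "AG_tuples k p s = {n \<in> {p..<k} \<rightarrow>\<^sub>E UNIV. AG_N k n p = s}"

text \<open>The tail of the multiple series in the indices p, ..., k - 1; the bound
  \<open>max i p\<close> keeps that portion of the linear term which lies in the tail.\<close>

definition AG_term :: "complex \<Rightarrow> nat \<Rightarrow> nat \<Rightarrow> nat \<Rightarrow> (nat \<Rightarrow> nat) \<Rightarrow> complex" where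
  "AG_term q k i p n =
     q ^ ((\<Sum>j\<in>{p..<k}. (AG_N k n j)\<^sup>2) + (\<Sum>j\<in>{max i p..<k}. AG_N k n j)) / (\<Prod>j\<in>{p..<k}. qpoch q q (n j))"

text \<open>Summing the multiple series over the tuples with prescribed \<open>N\<^sub>p = s\<close> turns it into an iterated sum
  of the shape produced by the Bailey steps.\<close>

definition AG_layer :: "complex \<Rightarrow> nat \<Rightarrow> nat \<Rightarrow> nat \<Rightarrow> nat \<Rightarrow> complex" where
  "AG_layer q k i p s = (\<Sum>n\<in>AG_tuples k p s. AG_term q k i p n)"

lemma AG_N_Suc: "p < k \<Longrightarrow> AG_N k n p = n p + AG_N k n (Suc p)"
  unfolding AG_N_def by (simp add: sum.atLeast_Suc_lessThan)

lemma AG_N_cong: "(\<And>j. p \<le> j \<Longrightarrow> j < k \<Longrightarrow> n j = m j) \<Longrightarrow> AG_N k n p = AG_N k m p"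
  unfolding AG_N_def by (intro sum.cong) auto

lemma entry_le_AG_N: "p \<le> j \<Longrightarrow> j < k \<Longrightarrow> n j \<le> AG_N k n p"
  unfolding AG_N_def by (rule member_le_sum) auto

lemma finite_AG_tuples: "finite (AG_tuples k p s)"
proof (rule finite_subset)
  show "AG_tuples k p s \<subseteq> {p..<k} \<rightarrow>\<^sub>E {..s}"
  proof
    fix n assume "n \<in> AG_tuples k p s"
    then have n: "n \<in> {p..<k} \<rightarrow>\<^sub>E UNIV" "AG_N k n p = s" by (auto simp: AG_tuples_def)
    have "n j \<le> s" if "j \<in> {p..<k}" for j
      using entry_le_AG_N[of p j k n] that n(2) by simp
    then show "n \<in> {p..<k} \<rightarrow>\<^sub>E {..s}" using n(1) by (simp add: PiE_iff)
  qed
qed (auto intro: finite_PiE)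

lemma AG_layer_self: "AG_layer q k i k s = (if s = 0 then 1 else 0)"
proof -
  have "AG_tuples k k s = (if s = 0 then {\<lambda>_. undefined} else {})"
    by (simp add: AG_tuples_def AG_N_def)
  then show ?thesis by (simp add: AG_layer_def AG_term_def)
qed

text \<open>Once t = N_(p+1) is known, the entry n_p = s - t is forced, so a tuple starting at p
  amounts to t together with a tuple starting at p + 1. Extensionality of the tuples makes this a
  bijection.\<close>

lemma AG_layer_rec:
  assumes "p < k"
  shows "AG_layer q k i p s = q ^ (s\<^sup>2 + (if i \<le> p then s else 0)) *
           (\<Sum>t\<le>s. inv_qpoch q (int (s - t)) * AG_layer q k i (Suc p) t)"
proof -
  let ?e = "if i \<le> p then s else 0"
  have upd: "AG_N k (m(p := x)) j = AG_N k m j" if "p < j" for m x j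
    using that by (intro AG_N_cong) auto
  have "AG_layer q k i p s =
      (\<Sum>(t, m)\<in>(SIGMA t:{..s}. AG_tuples k (Suc p) t).
         q ^ (s\<^sup>2 + ?e) * (inv_qpoch q (int (s - t)) * AG_term q k i (Suc p) m))"
    unfolding AG_layer_def
  proof (rule sum.reindex_bij_witness[where i = "\<lambda>(t, m). m(p := s - t)"
        and j = "\<lambda>n. (AG_N k n (Suc p), restrict n {Suc p..<k})"])
    fix n assume "n \<in> AG_tuples k p s"
    then have n: "n \<in> {p..<k} \<rightarrow>\<^sub>E UNIV" "AG_N k n p = s" by (auto simp: AG_tuples_def)
    let ?m = "restrict n {Suc p..<k}" and ?t = "AG_N k n (Suc p)"
    have s: "s = n p + ?t" using n AG_N_Suc[OF assms] by metis
    show "(case (?t, ?m) of (t, m) \<Rightarrow> m(p := s - t)) = n"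
      using n(1) s assms by (auto simp: PiE_iff extensional_def fun_eq_iff)
    have mN: "AG_N k ?m j = AG_N k n j" if "p < j" for j
      using that by (intro AG_N_cong) auto
    show "(?t, ?m) \<in> (SIGMA t:{..s}. AG_tuples k (Suc p) t)"
      using s mN by (auto simp: AG_tuples_def)
    have sq: "(\<Sum>j\<in>{p..<k}. (AG_N k n j)\<^sup>2) = s\<^sup>2 + (\<Sum>j\<in>{Suc p..<k}. (AG_N k ?m j)\<^sup>2)"
      using assms by (subst sum.atLeast_Suc_lessThan) (auto simp: n(2) mN intro!: sum.cong)
    have lin: "(\<Sum>j\<in>{max i p..<k}. AG_N k n j) = ?e + (\<Sum>j\<in>{max i (Suc p)..<k}. AG_N k ?m j)"
    proof (cases "i \<le> p")
      case True
      then show ?thesis using assms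
        by (simp add: max_def sum.atLeast_Suc_lessThan n(2) mN)
    next
      case False
      then have "max i p = i" "max i (Suc p) = i" by auto
      then show ?thesis using False by (auto simp: mN intro!: sum.cong)
    qed
    have "(\<Prod>j\<in>{p..<k}. qpoch q q (n j)) = qpoch q q (s - ?t) * (\<Prod>j\<in>{Suc p..<k}. qpoch q q (?m j))"
      using assms s by (subst prod.atLeast_Suc_lessThan) auto
    then show "(case (?t, ?m) of (t, m) \<Rightarrow> q ^ (s\<^sup>2 + ?e) * (inv_qpoch q (int (s - t)) * AG_term q k i (Suc p) m))
        = AG_term q k i p n"
      unfolding AG_term_def sq lin inv_qpoch_int by (simp add: power_add)
  next
    fix x assume "x \<in> (SIGMA t:{..s}. AG_tuples k (Suc p) t)"
    then obtain t m where x: "x = (t, m)" "t \<le> s" "m \<in> {Suc p..<k} \<rightarrow>\<^sub>E UNIV" "AG_N k m (Suc p) = t"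
      by (auto simp: AG_tuples_def)
    have "restrict (m(p := s - t)) {Suc p..<k} = m"
      using x(3) by (auto simp: PiE_iff extensional_def fun_eq_iff restrict_def)
    then show "(AG_N k (case x of (t, m) \<Rightarrow> m(p := s - t)) (Suc p),
        restrict (case x of (t, m) \<Rightarrow> m(p := s - t)) {Suc p..<k}) = x"
      by (simp add: x upd)
    show "(case x of (t, m) \<Rightarrow> m(p := s - t)) \<in> AG_tuples k p s"
      using x assms by (auto simp: AG_tuples_def AG_N_Suc[OF assms] upd PiE_iff extensional_def)
  qed
  also have "\<dots> = (\<Sum>t\<le>s. \<Sum>m\<in>AG_tuples k (Suc p) t. q ^ (s\<^sup>2 + ?e) * (inv_qpoch q (int (s - t)) * AG_term q k i (Suc p) m))"
    by (rule sum.Sigma[symmetric]) (auto simp: finite_AG_tuples)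
  finally show ?thesis
    by (simp add: AG_layer_def sum_distrib_left)
qed

text \<open>The convolution with 1/(q;q)_(n-s) is the one in a Bailey step, so a layer with linear
  term is a step relative to q. There are k - p + 1 steps for k - p layers, because the unit pair
  sits at s = 0, where the power of q in the first step is 1.\<close>

lemma AG_layer_bailey':
  assumes q: "norm q < 1" "q \<noteq> 0" and "i \<le> p" "p \<le> k"
  shows "(\<Sum>s\<le>n. inv_qpoch q (int (n - s)) * AG_layer q k i p s) = bailey' q (bailey_coeff q (Suc (k - p)) 0) n"
  using assms(4,3)
proof (induction p arbitrary: n rule: inc_induct)
  case base
  show ?case
    unfolding bailey'_coeff_Suc[OF q(1)] diff_self_eq_0 bailey'_unit[OF q] AG_layer_self
    by (rule sum.cong) auto
next
  case (step p)
  then have kp: "k - p = Suc (k - Suc p)" by auto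
  show ?case
    unfolding bailey'_coeff_Suc[OF q(1)]
  proof (rule sum.cong[OF refl])
    fix s
    show "inv_qpoch q (int (n - s)) * AG_layer q k i p s
        = q ^ (s\<^sup>2 + s) * inv_qpoch q (int (n - s)) * bailey' q (bailey_coeff q (k - p) 0) s"
      unfolding AG_layer_rec[OF step.hyps(2)] using step.prems step.IH[of s] kp by (simp only: if_True le_SucI mult_ac)
  qed
qed

text \<open>Below i the layers carry no linear term and become steps relative to 1. At p = i the
  pair relative to q is reread as a pair relative to 1, which \<open>bailey_eq_bailey'\<close>
  allows since no step of the second kind has been made yet.\<close>

lemma AG_layer_bailey:
  assumes q: "norm q < 1" "q \<noteq> 0" and "p \<le> i" "i \<le> k"
  shows "(\<Sum>s\<le>n. inv_qpoch q (int (n - s)) * AG_layer q k i p s) = bailey q (bailey_coeff q (Suc (k - i)) (i - p)) n"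
  using assms(3)
proof (induction p arbitrary: n rule: inc_induct)
  case base
  show ?case
    using AG_layer_bailey'[OF q, of i i k n] assms by (simp only: bailey_eq_bailey'[OF q] diff_self_eq_0 le_refl)
next
  case (step p)
  then have ip: "i - p = Suc (i - Suc p)" and pk: "p < k" and np: "\<not> i \<le> p" using assms by auto
  show ?case
    unfolding ip bailey_coeff_Suc[OF q(1)]
  proof (rule sum.cong[OF refl])
    fix s
    show "inv_qpoch q (int (n - s)) * AG_layer q k i p s
        = q ^ s\<^sup>2 * inv_qpoch q (int (n - s)) * bailey q (bailey_coeff q (Suc (k - i)) (i - Suc p)) s"
      unfolding AG_layer_rec[OF pk] using step.IH[of s] np by (simp only: if_False add_0_right mult_ac)
  qed
qed

section \<open>Absolute convergence of the multiple series\<close>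

lemma summable_on_prod_PiE_nonneg:
  fixes f :: "'a \<Rightarrow> 'b \<Rightarrow> real"
  assumes "finite A" and nn: "\<And>x y. x \<in> A \<Longrightarrow> f x y \<ge> 0" and su: "\<And>x. x \<in> A \<Longrightarrow> f x summable_on UNIV"
  shows "(\<lambda>g. \<Prod>x\<in>A. f x (g x)) summable_on (A \<rightarrow>\<^sub>E UNIV)"
proof (rule nonneg_bdd_above_summable_on)
  show "bdd_above (sum (\<lambda>g. \<Prod>x\<in>A. f x (g x)) ` {F. F \<subseteq> A \<rightarrow>\<^sub>E UNIV \<and> finite F})"
  proof (rule bdd_aboveI2)
    fix F assume "F \<in> {F. F \<subseteq> A \<rightarrow>\<^sub>E (UNIV :: 'b set) \<and> finite F}"
    then have F: "F \<subseteq> A \<rightarrow>\<^sub>E UNIV" "finite F" by auto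
    define B where "B x = (\<lambda>g. g x) ` F" for x
    \<comment> \<open>A finite set of functions lies in a finite box, over which the sum of products
      factorises.\<close>
    have "(\<Sum>g\<in>F. \<Prod>x\<in>A. f x (g x)) \<le> (\<Sum>g\<in>PiE A B. \<Prod>x\<in>A. f x (g x))"
    proof (rule sum_mono2)
      show "finite (PiE A B)" using F \<open>finite A\<close> by (auto simp: B_def intro!: finite_PiE)
      show "F \<subseteq> PiE A B" using F by (auto simp: B_def PiE_iff)
    qed (rule prod_nonneg, rule nn)
    also have "\<dots> = (\<Prod>x\<in>A. \<Sum>y\<in>B x. f x y)"
      using F \<open>finite A\<close> by (subst prod_sum_PiE) (auto simp: B_def)
    also have "\<dots> \<le> (\<Prod>x\<in>A. infsum (f x) UNIV)"
    proof (rule prod_mono, rule conjI)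
      fix x assume x: "x \<in> A"
      show "sum (f x) (B x) \<ge> 0" by (rule sum_nonneg, rule nn[OF x])
      show "sum (f x) (B x) \<le> infsum (f x) UNIV"
        using F by (intro finite_sum_le_infsum su[OF x] nn[OF x]) (auto simp: B_def)
    qed
    finally show "(\<Sum>g\<in>F. \<Prod>x\<in>A. f x (g x)) \<le> (\<Prod>x\<in>A. infsum (f x) UNIV)" .
  qed
qed (rule prod_nonneg, rule nn)

text \<open>An absolutely convergent product without vanishing factors has a nonzero limit; this is
  what makes the reciprocals converge and stay bounded.\<close>

lemma qpoch_limit:
  assumes q: "norm q < 1"
  obtains L where "(\<lambda>n. qpoch q q n) \<longlonglongrightarrow> L" "L \<noteq> 0"
proof -
  have "summable (\<lambda>n. norm ((1 - q * q ^ n) - 1))"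
    using q by (simp add: norm_mult norm_power summable_mult)
  then have "abs_convergent_prod (\<lambda>n. 1 - q * q ^ n)"
    by (rule summable_imp_abs_convergent_prod)
  then have c: "convergent_prod (\<lambda>n. 1 - q * q ^ n)"
    by (rule abs_convergent_prod_imp_convergent_prod)
  have nz: "1 - q * q ^ n \<noteq> 0" for n
    using qpoch_nonzero[OF q, of "Suc n"] by (simp add: qpoch_Suc)
  have "(\<lambda>n. qpoch q q (Suc n)) \<longlonglongrightarrow> prodinf (\<lambda>n. 1 - q * q ^ n)"
    using convergent_prod_LIMSEQ[OF c] by (simp add: qpoch_def lessThan_Suc_atMost del: prod.lessThan_Suc)
  then have "(\<lambda>n. qpoch q q n) \<longlonglongrightarrow> prodinf (\<lambda>n. 1 - q * q ^ n)"
    by (subst (asm) filterlim_sequentially_Suc)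
  moreover have "prodinf (\<lambda>n. 1 - q * q ^ n) \<noteq> 0"
    using has_prod_eq_0_iff[OF convergent_prod_has_prod[OF c]] nz by (simp add: image_iff)
  ultimately show ?thesis using that by blast
qed

lemma inv_qpoch_limit:
  assumes q: "norm q < 1"
  obtains L where "(\<lambda>n. inv_qpoch q (int n)) \<longlonglongrightarrow> L" "L \<noteq> 0"
proof -
  obtain L where "(\<lambda>n. qpoch q q n) \<longlonglongrightarrow> L" "L \<noteq> 0"
    by (rule qpoch_limit[OF q])
  then have "(\<lambda>n. inv_qpoch q (int n)) \<longlonglongrightarrow> 1 / L"
    unfolding inv_qpoch_int by (intro tendsto_intros)
  then show ?thesis using that[of "1 / L"] \<open>L \<noteq> 0\<close> by simp
qed

lemma inv_qpoch_bound:
  assumes q: "norm q < 1"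
  obtains C where "C \<ge> 1" "\<forall>m. norm (inv_qpoch q m) \<le> C"
proof -
  obtain L where "(\<lambda>n. inv_qpoch q (int n)) \<longlonglongrightarrow> L"
    by (rule inv_qpoch_limit[OF q])
  then have "Bseq (\<lambda>n. inv_qpoch q (int n))" using convergent_imp_Bseq convergent_def by blast
  then obtain C where C: "\<And>n. norm (inv_qpoch q (int n)) \<le> C" by (auto simp: Bseq_def)
  have "norm (inv_qpoch q m) \<le> max C 1" for m
    using C[of "nat m"] by (cases "m \<ge> 0") auto
  then show ?thesis using that[of "max C 1"] by auto
qed

text \<open>Since N_j^2 >= N_j >= n_j and |q| < 1, a term is dominated by the product of the C
  |q|^(n_j), where C bounds all 1/(q;q)_m.\<close>

lemma AG_term_summable:
  assumes q: "norm q < 1"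
  shows "(\<lambda>n. norm (AG_term q k i p n)) summable_on ({p..<k} \<rightarrow>\<^sub>E UNIV)"
proof -
  obtain C where C: "C \<ge> 1" "\<forall>m. norm (inv_qpoch q m) \<le> C" by (rule inv_qpoch_bound[OF q])
  have "(\<lambda>n. C * norm q ^ n) summable_on (UNIV :: nat set)"
  proof (rule summable_on_cmult_right)
    have "summable (\<lambda>n. norm (norm q ^ n))" using q by (simp add: summable_geometric)
    then show "(\<lambda>n. norm q ^ n) summable_on (UNIV :: nat set)" by (rule norm_summable_imp_summable_on)
  qed
  then have s: "(\<lambda>n. \<Prod>j\<in>{p..<k}. C * norm q ^ n j) summable_on ({p..<k} \<rightarrow>\<^sub>E (UNIV :: nat set))"
    using C(1) by (intro summable_on_prod_PiE_nonneg) auto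
  show ?thesis
  proof (rule Infinite_Sum.abs_summable_on_comparison_test'[OF s])
    fix n :: "nat \<Rightarrow> nat"
    let ?E = "(\<Sum>j\<in>{p..<k}. (AG_N k n j)\<^sup>2) + (\<Sum>j\<in>{max i p..<k}. AG_N k n j)"
    have "(\<Sum>j\<in>{p..<k}. n j) \<le> (\<Sum>j\<in>{p..<k}. (AG_N k n j)\<^sup>2)"
    proof (rule sum_mono)
      fix j assume "j \<in> {p..<k}"
      then have "n j \<le> AG_N k n j" by (intro entry_le_AG_N) auto
      also have "\<dots> \<le> (AG_N k n j)\<^sup>2" by (simp add: power2_eq_square)
      finally show "n j \<le> (AG_N k n j)\<^sup>2" .
    qed
    then have "norm q ^ ?E \<le> norm q ^ (\<Sum>j\<in>{p..<k}. n j)"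
      using q by (intro power_decreasing) auto
    also have "\<dots> = (\<Prod>j\<in>{p..<k}. norm q ^ n j)" by (rule power_sum)
    finally have E: "norm q ^ ?E \<le> (\<Prod>j\<in>{p..<k}. norm q ^ n j)" .
    have "AG_term q k i p n = q ^ ?E * (\<Prod>j\<in>{p..<k}. inv_qpoch q (int (n j)))"
      unfolding AG_term_def inv_qpoch_int prod_dividef by (simp only: prod.neutral_const times_divide_eq_right mult_1_right)
    then have "norm (AG_term q k i p n) = norm q ^ ?E * (\<Prod>j\<in>{p..<k}. norm (inv_qpoch q (int (n j))))"
      by (simp only: norm_mult norm_power prod_norm)
    also have "\<dots> \<le> (\<Prod>j\<in>{p..<k}. norm q ^ n j) * (\<Prod>j\<in>{p..<k}. norm (inv_qpoch q (int (n j))))"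
      by (rule mult_right_mono[OF E]) (simp add: prod_nonneg)
    also have "\<dots> \<le> (\<Prod>j\<in>{p..<k}. norm q ^ n j) * (\<Prod>j\<in>{p..<k}. C)"
      using C by (intro mult_left_mono prod_mono prod_nonneg) auto
    finally show "norm (AG_term q k i p n) \<le> (\<Prod>j\<in>{p..<k}. C * norm q ^ n j)"
      by (simp only: prod.distrib mult.commute)
  qed
qed

text \<open>Grouping the absolutely convergent multiple series by the value of N_1 leaves a simple
  series, the form in which the limit of the finite Bailey identity can be taken.\<close>

lemma AG_layer_sums:
  assumes q: "norm q < 1" and i: "i \<ge> 1"
  shows "summable (\<lambda>s. norm (AG_layer q k i 1 s))" and "AG_layer q k i 1 sums AG_series k i q"
proof -
  let ?P = "{1..<k} \<rightarrow>\<^sub>E (UNIV :: nat set)"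
  have img: "snd ` (SIGMA s:UNIV. AG_tuples k 1 s) = ?P" "inj_on snd (SIGMA s:UNIV. AG_tuples k 1 s)"
    by (force simp: AG_tuples_def) (auto simp: AG_tuples_def inj_on_def)
  have "AG_series k i q = infsum (AG_term q k i 1) ?P"
    using i by (simp add: AG_series_def AG_term_def[abs_def] max_def)
  moreover have "AG_term q k i 1 summable_on ?P"
    using AG_term_summable[OF q] by (rule abs_summable_summable)
  ultimately have "(AG_term q k i 1 has_sum AG_series k i q) (snd ` (SIGMA s:UNIV. AG_tuples k 1 s))"
    unfolding img by simp
  then have "((\<lambda>(s, n). AG_term q k i 1 n) has_sum AG_series k i q) (SIGMA s:UNIV. AG_tuples k 1 s)"
    by (subst (asm) has_sum_reindex[OF img(2)]) (simp add: o_def case_prod_unfold)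
  then have "(AG_layer q k i 1 has_sum AG_series k i q) UNIV"
    by (rule has_sum_Sigma') (auto simp: AG_layer_def intro!: has_sum_finiteI finite_AG_tuples)
  then show "AG_layer q k i 1 sums AG_series k i q" by (rule has_sum_imp_sums)
  have "(\<lambda>n. norm (AG_term q k i 1 n)) summable_on (snd ` (SIGMA s:UNIV. AG_tuples k 1 s))"
    unfolding img by (rule AG_term_summable[OF q])
  then have "(\<lambda>(s, n). norm (AG_term q k i 1 n)) summable_on (SIGMA s:UNIV. AG_tuples k 1 s)"
    by (subst (asm) summable_on_reindex[OF img(2)]) (simp add: o_def case_prod_unfold)
  then have "(\<lambda>s. \<Sum>n\<in>AG_tuples k 1 s. norm (AG_term q k i 1 n)) summable_on UNIV"
    by (drule_tac summable_on_Sigma_banach) (simp add: finite_AG_tuples)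
  then have "summable (\<lambda>s. \<Sum>n\<in>AG_tuples k 1 s. norm (AG_term q k i 1 n))"
    by (rule summable_on_imp_summable)
  then show "summable (\<lambda>s. norm (AG_layer q k i 1 s))"
    by (rule summable_comparison_test') (auto simp: AG_layer_def norm_sum)
qed

section \<open>Letting the upper index of the Bailey chain tend to infinity\<close>

lemma tendsto_infsum_dominated:
  fixes f :: "'b \<Rightarrow> 'a \<Rightarrow> 'c :: banach"
  assumes lim: "\<And>x. x \<in> A \<Longrightarrow> ((\<lambda>n. f n x) \<longlongrightarrow> g x) F"
    and bound: "\<And>n x. x \<in> A \<Longrightarrow> norm (f n x) \<le> M x"
    and summable: "M summable_on A" and F: "F \<noteq> bot"
  shows "((\<lambda>n. \<Sum>\<^sub>\<infinity>x\<in>A. f n x) \<longlongrightarrow> (\<Sum>\<^sub>\<infinity>x\<in>A. g x)) F"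
\<comment> \<open>By the M-test the finite partial sums converge uniformly in the parameter n, which
  permits the exchange of the two limits.\<close>
proof (rule swap_uniform_limit')
  have "norm (g x) \<le> M x" if "x \<in> A" for x
    by (rule tendsto_upperbound[OF tendsto_norm[OF lim[OF that]]]) (use bound that F in auto)
  then have "g summable_on A"
    by (rule abs_summable_summable[OF Infinite_Sum.abs_summable_on_comparison_test'[OF summable]])
  then show "(sum g \<longlongrightarrow> (\<Sum>\<^sub>\<infinity>x\<in>A. g x)) (finite_subsets_at_top A)"
    by (simp add: has_sum_def[symmetric] del: has_sum_infsum) (simp)
  show "\<forall>\<^sub>F X in finite_subsets_at_top A. ((\<lambda>n. \<Sum>x\<in>X. f n x) \<longlongrightarrow> sum g X) F"
    by (rule eventually_finite_subsets_at_top_weakI) (auto intro!: tendsto_sum lim)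
  show "uniform_limit UNIV (\<lambda>X n. \<Sum>x\<in>X. f n x) (\<lambda>n. \<Sum>\<^sub>\<infinity>x\<in>A. f n x) (finite_subsets_at_top A)"
    by (rule Weierstrass_m_test_general[OF bound summable])
qed (use F in auto)

lemma summable_on_int_power:
  fixes x :: real
  assumes "0 \<le> x" "x < 1"
  shows "(\<lambda>j::int. x ^ nat \<bar>j\<bar>) summable_on UNIV"
proof -
  have s: "(\<lambda>n::nat. x ^ n) summable_on UNIV"
    by (rule norm_summable_imp_summable_on) (use assms in \<open>simp add: summable_geometric\<close>)
  have "(\<lambda>j::int. x ^ nat \<bar>j\<bar>) summable_on range int"
    by (subst summable_on_reindex) (use s in \<open>auto simp: o_def\<close>)
  moreover have "(\<lambda>j::int. x ^ nat \<bar>j\<bar>) summable_on range (\<lambda>n. - int n)"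
    by (subst summable_on_reindex) (use s in \<open>auto simp: o_def inj_on_def\<close>)
  ultimately have "(\<lambda>j::int. x ^ nat \<bar>j\<bar>) summable_on (range int \<union> range (\<lambda>n. - int n))"
    by (rule summable_on_union)
  moreover have "j \<in> range int \<union> range (\<lambda>n. - int n)" for j
    by (cases j rule: int_cases2) auto
  then have "range int \<union> range (\<lambda>n. - int n) = UNIV" by blast
  ultimately show ?thesis by simp
qed

text \<open>A single step relative to q yields enough decay: for j >= 0 already j^2 + j is at least
  |j|, and for j < 0 the triangular number j (j - 1) / 2 is.\<close>

lemma bailey_coeff_bound:
  assumes q: "norm q < 1" and "a \<ge> 1"
  shows "norm (bailey_coeff q a b j) \<le> norm q ^ nat \<bar>j\<bar>"
proof -
  have d: "2 * (j * (j - 1) div 2) = j * (j - 1)" by simp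
  have "\<bar>j\<bar> \<le> j\<^sup>2 + j + j * (j - 1) div 2"
  proof (cases "j \<ge> 0")
    case True
    have "j * (j - 1) \<ge> 0" using True by (cases "j = 0") auto
    then have "j * (j - 1) div 2 \<ge> 0" by linarith
    then show ?thesis using True by (simp add: abs_if)
  next
    case False
    have "j * j \<ge> - j" using False mult_right_mono_neg[of j "-1" j] by simp
    moreover have "2 * (j * (j - 1) div 2) = j * j - j" using d by (simp add: algebra_simps)
    ultimately show ?thesis using False unfolding power2_eq_square by linarith
  qed
  moreover have "j\<^sup>2 + j \<ge> 0"
    using mult_nonneg_nonneg[of j "j + 1"] mult_nonpos_nonpos[of j "j + 1"]
    by (cases "j \<ge> 0") (auto simp: power2_eq_square algebra_simps)
  ultimately have "nat \<bar>j\<bar> \<le> nat (j\<^sup>2 + j) + nat (j * (j - 1) div 2)" by linarith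
  also have "\<dots> \<le> b * nat (j\<^sup>2) + a * nat (j\<^sup>2 + j) + nat (j * (j - 1) div 2)"
  proof -
    have "nat (j\<^sup>2 + j) \<le> a * nat (j\<^sup>2 + j)" using assms(2) by (cases a) auto
    then show ?thesis by linarith
  qed
  finally have "norm q ^ (b * nat (j\<^sup>2) + a * nat (j\<^sup>2 + j) + nat (j * (j - 1) div 2)) \<le> norm q ^ nat \<bar>j\<bar>"
    using q by (intro power_decreasing) auto
  then show ?thesis
    by (simp add: bailey_coeff_def norm_mult norm_power norm_power_int)
qed

lemma bailey_coeff_summable:
  assumes q: "norm q < 1" and "a \<ge> 1"
  shows "bailey_coeff q a b summable_on UNIV"
  using abs_summable_summable[OF Infinite_Sum.abs_summable_on_comparison_test'[OF summable_on_int_power[of "norm q"]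
      bailey_coeff_bound[OF q assms(2)]]] q by auto

lemma inv_qpoch_shift_limit:
  assumes L: "(\<lambda>n. inv_qpoch q (int n)) \<longlonglongrightarrow> L"
  shows "(\<lambda>n. inv_qpoch q (int n + j)) \<longlonglongrightarrow> L"
proof -
  have "filterlim (\<lambda>n. nat (int n + j)) at_top sequentially"
    unfolding filterlim_at_top
  proof
    fix Z
    show "\<forall>\<^sub>F n in sequentially. Z \<le> nat (int n + j)"
      using eventually_ge_at_top[of "Z + nat \<bar>j\<bar>"] by eventually_elim auto
  qed
  then have "(\<lambda>n. inv_qpoch q (int (nat (int n + j)))) \<longlonglongrightarrow> L"
    by (rule filterlim_compose[OF L])
  moreover have "\<forall>\<^sub>F n in sequentially. inv_qpoch q (int (nat (int n + j))) = inv_qpoch q (int n + j)"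
    using eventually_ge_at_top[of "nat \<bar>j\<bar>"] by eventually_elim auto
  ultimately show ?thesis by (rule Lim_transform_eventually)
qed

text \<open>In the limit the layer side of the finite identity becomes \<open>L\<close> times the
  series, whereas the Bailey side acquires two factors \<open>L\<close>, one from each reciprocal.
  Cancelling leaves one, and it is 1/(q;q)_\<infinity>.\<close>

theorem AG_series_eq_bilateral:
  assumes q: "norm q < 1" "q \<noteq> 0" and i: "1 \<le> i" "i \<le> k"
    and L: "(\<lambda>n. inv_qpoch q (int n)) \<longlonglongrightarrow> L"
  shows "AG_series k i q = L * (\<Sum>\<^sub>\<infinity>j. bailey_coeff q (Suc (k - i)) (i - 1) j)"
proof -
  let ?c = "bailey_coeff q (Suc (k - i)) (i - 1)" and ?U = "AG_layer q k i 1"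
  obtain C where C: "C \<ge> 1" "\<forall>m. norm (inv_qpoch q m) \<le> C" by (rule inv_qpoch_bound[OF q(1)])
  have nz: "L \<noteq> 0"
  proof -
    obtain L' where "(\<lambda>n. inv_qpoch q (int n)) \<longlonglongrightarrow> L'" "L' \<noteq> 0" by (rule inv_qpoch_limit[OF q(1)])
    then show ?thesis using L LIMSEQ_unique by blast
  qed
  have "(\<lambda>n. \<Sum>\<^sub>\<infinity>s. inv_qpoch q (int n + - int s) * ?U s) \<longlonglongrightarrow> (\<Sum>\<^sub>\<infinity>s. L * ?U s)"
  proof (rule tendsto_infsum_dominated[where M = "\<lambda>s. C * norm (?U s)"])
    show "(\<lambda>s. C * norm (?U s)) summable_on UNIV"
      using AG_layer_sums(1)[OF q(1) i(1), of k]
      by (intro summable_on_cmult_right norm_summable_imp_summable_on) simp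
    show "(\<lambda>n. inv_qpoch q (int n + - int s) * ?U s) \<longlonglongrightarrow> L * ?U s" for s
      by (intro tendsto_mult tendsto_const inv_qpoch_shift_limit[OF L])
    show "norm (inv_qpoch q (int n + - int s) * ?U s) \<le> C * norm (?U s)" for n s
      unfolding norm_mult by (rule mult_right_mono[OF spec[OF C(2)] norm_ge_zero])
  qed simp
  also have "(\<Sum>\<^sub>\<infinity>s. L * ?U s) = L * AG_series k i q"
  proof -
    have "(?U has_sum AG_series k i q) UNIV"
      using AG_layer_sums[OF q(1) i(1), of k] by (intro norm_summable_imp_has_sum) auto
    then show ?thesis by (intro infsumI has_sum_cmult_right)
  qed
  \<comment> \<open>For fixed n both sums are finite, negative indices contributing 0, and they
    agree by \<open>AG_layer_bailey\<close> at p = 1.\<close>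
  also have "(\<lambda>n. \<Sum>\<^sub>\<infinity>s. inv_qpoch q (int n + - int s) * ?U s) = (\<lambda>n. \<Sum>\<^sub>\<infinity>j. ?c j * inv_qpoch q (int n + - j) * inv_qpoch q (int n + j))"
  proof
    fix n
    have "(\<Sum>\<^sub>\<infinity>s. inv_qpoch q (int n + - int s) * ?U s) = (\<Sum>\<^sub>\<infinity>s\<in>{..n}. inv_qpoch q (int n + - int s) * ?U s)"
      by (rule infsum_cong_neutral) auto
    also have "\<dots> = (\<Sum>s\<le>n. inv_qpoch q (int (n - s)) * ?U s)"
      by (auto simp: of_nat_diff intro!: sum.cong)
    also have "\<dots> = bailey q ?c n"
      by (rule AG_layer_bailey[OF q i])
    also have "\<dots> = (\<Sum>\<^sub>\<infinity>j\<in>{-int n..int n}. ?c j * inv_qpoch q (int n + - j) * inv_qpoch q (int n + j))"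
      by (simp add: bailey_def)
    also have "\<dots> = (\<Sum>\<^sub>\<infinity>j. ?c j * inv_qpoch q (int n + - j) * inv_qpoch q (int n + j))"
      by (rule infsum_cong_neutral) auto
    finally show "(\<Sum>\<^sub>\<infinity>s. inv_qpoch q (int n + - int s) * ?U s) = \<dots>" .
  qed
  finally have 1: "(\<lambda>n. \<Sum>\<^sub>\<infinity>j. ?c j * inv_qpoch q (int n + - j) * inv_qpoch q (int n + j)) \<longlonglongrightarrow> L * AG_series k i q" .
  have 2: "(\<lambda>n. \<Sum>\<^sub>\<infinity>j. ?c j * inv_qpoch q (int n + - j) * inv_qpoch q (int n + j)) \<longlonglongrightarrow> (\<Sum>\<^sub>\<infinity>j. ?c j * L * L)"
  proof (rule tendsto_infsum_dominated[where M = "\<lambda>j. norm q ^ nat \<bar>j\<bar> * C * C"])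
    show "(\<lambda>j. norm q ^ nat \<bar>j\<bar> * C * C) summable_on UNIV"
      by (intro summable_on_cmult_left summable_on_int_power) (use q in auto)
    fix n and j :: int
    show "norm (?c j * inv_qpoch q (int n + - j) * inv_qpoch q (int n + j)) \<le> norm q ^ nat \<bar>j\<bar> * C * C"
      unfolding norm_mult using C bailey_coeff_bound[OF q(1), of "Suc (k - i)" "i - 1" j]
      by (intro mult_mono) auto
    show "(\<lambda>n. ?c j * inv_qpoch q (int n + - j) * inv_qpoch q (int n + j)) \<longlonglongrightarrow> ?c j * L * L"
      by (intro tendsto_mult tendsto_const inv_qpoch_shift_limit[OF L])
  qed simp
  have "L * AG_series k i q = (\<Sum>\<^sub>\<infinity>j. ?c j * L * L)"
    by (rule LIMSEQ_unique[OF 1 2])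
  also have "\<dots> = (\<Sum>\<^sub>\<infinity>j. ?c j) * L * L"
    using bailey_coeff_summable[OF q(1), of "Suc (k - i)" "i - 1"]
    by (subst infsum_cmult_left, simp add: summable_on_cmult_left)+ simp
  finally show ?thesis using nz by (simp add: mult_ac)
qed

section \<open>Theta series\<close>

lemma holomorphic_on_infsum:
  fixes f :: "'a \<Rightarrow> complex \<Rightarrow> complex"
  assumes "open S" and hol: "\<And>n. n \<in> A \<Longrightarrow> f n holomorphic_on S"
    and bound: "\<And>x. x \<in> S \<Longrightarrow> \<exists>d M. 0 < d \<and> cball x d \<subseteq> S \<and> M summable_on A \<and> (\<forall>n\<in>A. \<forall>y\<in>cball x d. norm (f n y) \<le> M n)"
  shows "(\<lambda>z. \<Sum>\<^sub>\<infinity>n\<in>A. f n z) holomorphic_on S"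
proof -
  let ?g = "\<lambda>z. \<Sum>\<^sub>\<infinity>n\<in>A. f n z"
  have "?g field_differentiable (at x)" if x: "x \<in> S" for x
  proof -
    obtain d M where d: "0 < d" "cball x d \<subseteq> S" and M: "M summable_on A"
      "\<And>n y. n \<in> A \<Longrightarrow> y \<in> cball x d \<Longrightarrow> norm (f n y) \<le> M n" using bound[OF x] by blast
    have ul: "uniform_limit (cball x d) (\<lambda>X z. \<Sum>n\<in>X. f n z) ?g (finite_subsets_at_top A)"
      by (rule Weierstrass_m_test_general[OF M(2,1)])
    have "?g holomorphic_on ball x d"
    proof (rule holomorphic_uniform_limit[OF _ ul])
      show "\<forall>\<^sub>F X in finite_subsets_at_top A.
          continuous_on (cball x d) (\<lambda>z. \<Sum>n\<in>X. f n z) \<and> (\<lambda>z. \<Sum>n\<in>X. f n z) holomorphic_on ball x d"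
      proof (rule eventually_finite_subsets_at_top_weakI)
        fix X assume "finite X" "X \<subseteq> A"
        then have h: "(\<lambda>z. \<Sum>n\<in>X. f n z) holomorphic_on S" using hol by (auto intro!: holomorphic_intros)
        have "ball x d \<subseteq> S" using d(2) ball_subset_cball by blast
        then show "continuous_on (cball x d) (\<lambda>z. \<Sum>n\<in>X. f n z) \<and> (\<lambda>z. \<Sum>n\<in>X. f n z) holomorphic_on ball x d"
          using h d(2) by (meson holomorphic_on_imp_continuous_on holomorphic_on_subset continuous_on_subset)
      qed
    qed auto
    then show ?thesis
      using d(1) by (metis centre_in_ball open_ball holomorphic_on_imp_differentiable_at)
  qed
  then show ?thesis by (simp add: holomorphic_on_def field_differentiable_at_within)
qed

text \<open>At w = - \<i> K \<tau> the exponential is that of \<pi> \<i> K \<tau> (n + z)^2. With w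
  in the right half plane, the positive reals, where Poisson summation takes place, correspond to
  purely imaginary \<tau>.\<close>

definition theta_term :: "int \<Rightarrow> complex \<Rightarrow> complex \<Rightarrow> complex" where
  "theta_term n z w = (-1) powi n * exp (- (of_real pi * w * (of_int n + z)\<^sup>2))"

definition theta :: "complex \<Rightarrow> complex \<Rightarrow> complex" where
  "theta z w = (\<Sum>\<^sub>\<infinity>n. theta_term n z w)"

text \<open>With t = |n|, the real part of w (n + z)^2 is at least d t^2 - 2 W B t - W B^2. This
  quadratic lies above the line t - C, which yields a geometric majorant independent of z and
  w.\<close>

lemma theta_term_bound:
  fixes d W B :: real
  assumes "0 < d"
  shows "\<exists>M. M summable_on UNIV \<and>
    (\<forall>n z w. d \<le> Re w \<longrightarrow> norm w \<le> W \<longrightarrow> norm z \<le> B \<longrightarrow> norm (theta_term n z w) \<le> M n)"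
proof (intro exI conjI allI impI)
  \<comment> \<open>The first summand completes d t^2 - (2 W B + 1) t to d times a square; the
    second absorbs the term with z^2.\<close>
  define C where "C = (2 * W * B + 1)\<^sup>2 / (4 * d) + W * B\<^sup>2"
  let ?M = "\<lambda>n::int. exp (pi * C) * exp (- pi) ^ nat \<bar>n\<bar>"
  show "?M summable_on UNIV"
    by (intro summable_on_cmult_right summable_on_int_power) auto
  fix n and z w :: complex assume w: "d \<le> Re w" "norm w \<le> W" and z: "norm z \<le> B"
  define t where "t = \<bar>real_of_int n\<bar>"
  have t2: "(real_of_int n)\<^sup>2 = t\<^sup>2" by (simp add: t_def)
  have "norm (of_int n * (w * z)) = t * (norm w * norm z)"
    by (simp add: norm_mult t_def)
  also have "\<dots> \<le> t * (W * B)"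
    using w z by (intro mult_left_mono mult_mono) (auto simp: t_def intro: order_trans[OF norm_ge_zero])
  finally have 1: "Re (of_int n * (w * z)) \<ge> - (t * (W * B))"
    using abs_Re_le_cmod[of "of_int n * (w * z)"] by linarith
  have "norm (w * z\<^sup>2) = norm w * (norm z)\<^sup>2" by (simp add: norm_mult norm_power)
  also have "\<dots> \<le> W * B\<^sup>2"
    using w z by (intro mult_mono power_mono) (auto intro: order_trans[OF norm_ge_zero])
  finally have 2: "Re (w * z\<^sup>2) \<ge> - (W * B\<^sup>2)"
    using abs_Re_le_cmod[of "w * z\<^sup>2"] by linarith
  have 3: "Re w * t\<^sup>2 \<ge> d * t\<^sup>2" using w by (intro mult_right_mono) auto
  have "0 \<le> d * (t - (2 * W * B + 1) / (2 * d))\<^sup>2" using assms by simp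
  also have "\<dots> = d * t\<^sup>2 - (2 * W * B + 1) * t + (2 * W * B + 1)\<^sup>2 / (4 * d)"
    using assms by (simp add: power2_eq_square field_simps)
  finally have 4: "d * t\<^sup>2 - 2 * (t * (W * B)) - W * B\<^sup>2 \<ge> t - C"
    unfolding C_def by (simp add: algebra_simps)
  have "w * (of_int n + z)\<^sup>2 = w * of_real ((real_of_int n)\<^sup>2) + 2 * (of_int n * (w * z)) + w * z\<^sup>2"
    by (simp add: power2_eq_square algebra_simps)
  then have "Re (w * (of_int n + z)\<^sup>2) = Re w * t\<^sup>2 + 2 * Re (of_int n * (w * z)) + Re (w * z\<^sup>2)"
    by (simp only: plus_complex.simps Re_complex_of_real times_complex.simps Im_complex_of_real t2) simp
  then have "Re (w * (of_int n + z)\<^sup>2) \<ge> t - C" using 1 2 3 4 by linarith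
  then have "exp (- (pi * Re (w * (of_int n + z)\<^sup>2))) \<le> exp (pi * C + real (nat \<bar>n\<bar>) * (- pi))"
    using mult_left_mono[of "t - C" "Re (w * (of_int n + z)\<^sup>2)" pi] by (simp add: t_def algebra_simps)
  moreover have "norm (theta_term n z w) = exp (- (pi * Re (w * (of_int n + z)\<^sup>2)))"
    unfolding theta_term_def norm_mult norm_exp_eq_Re norm_power_int
    by (simp only: mult.assoc uminus_complex.simps Re_complex_of_real times_complex.simps(1) Im_complex_of_real) simp
  ultimately show "norm (theta_term n z w) \<le> ?M n"
    by (simp only: exp_add exp_of_nat_mult)
qed

lemma theta_term_abs_summable:
  assumes "0 < Re w"
  shows "(\<lambda>n. norm (theta_term n z w)) summable_on UNIV"
proof -
  obtain M where M: "M summable_on (UNIV :: int set)"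
    "\<forall>n z' w'. Re w \<le> Re w' \<longrightarrow> norm w' \<le> norm w \<longrightarrow> norm z' \<le> norm z \<longrightarrow> norm (theta_term n z' w') \<le> M n"
    using theta_term_bound[OF assms] by blast
  show ?thesis
    by (rule Infinite_Sum.abs_summable_on_comparison_test'[OF M(1)]) (use M(2) in auto)
qed

lemma theta_term_summable:
  assumes "0 < Re w"
  shows "(\<lambda>n. theta_term n z w) summable_on UNIV"
  by (rule abs_summable_summable[OF theta_term_abs_summable[OF assms]])

lemma holomorphic_theta_left:
  assumes "0 < Re w"
  shows "(\<lambda>z. theta z w) holomorphic_on UNIV"
  unfolding theta_def
proof (rule holomorphic_on_infsum)
  fix x :: complex
  obtain M where M: "M summable_on (UNIV :: int set)"
    "\<forall>n z' w'. Re w \<le> Re w' \<longrightarrow> norm w' \<le> norm w \<longrightarrow> norm z' \<le> norm x + 1 \<longrightarrow> norm (theta_term n z' w') \<le> M n"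
    using theta_term_bound[OF assms] by blast
  have "norm y \<le> norm x + 1" if "y \<in> cball x 1" for y
    using that norm_triangle_sub[of y x] by (simp add: dist_norm norm_minus_commute)
  then show "\<exists>d M. 0 < d \<and> cball x d \<subseteq> UNIV \<and> M summable_on UNIV \<and> (\<forall>n\<in>UNIV. \<forall>y\<in>cball x d. norm (theta_term n y w) \<le> M n)"
    using M by (intro exI[of _ 1] exI[of _ M]) auto
qed (auto simp: theta_term_def intro!: holomorphic_intros)

lemma holomorphic_theta_right: "theta z holomorphic_on {w. 0 < Re w}"
  unfolding theta_def
proof (rule holomorphic_on_infsum)
  show "open {w. 0 < Re w}" by (rule open_halfspace_Re_gt)
  fix x assume "x \<in> {w. 0 < Re w}"
  then have x: "0 < Re x / 2" by simp
  obtain M where M: "M summable_on (UNIV :: int set)"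
    "\<forall>n z' w'. Re x / 2 \<le> Re w' \<longrightarrow> norm w' \<le> norm x + Re x / 2 \<longrightarrow> norm z' \<le> norm z \<longrightarrow> norm (theta_term n z' w') \<le> M n"
    using theta_term_bound[OF x] by blast
  have 1: "norm y \<le> norm x + Re x / 2" if "y \<in> cball x (Re x / 2)" for y
    using that norm_triangle_sub[of y x] by (simp add: dist_norm norm_minus_commute)
  have 2: "Re x / 2 \<le> Re y" if "y \<in> cball x (Re x / 2)" for y
    using that abs_Re_le_cmod[of "x - y"] by (simp add: dist_norm)
  have 3: "0 < Re y" if "y \<in> cball x (Re x / 2)" for y
    using 2[OF that] x by linarith
  show "\<exists>d M. 0 < d \<and> cball x d \<subseteq> {w. 0 < Re w} \<and> M summable_on UNIV \<and> (\<forall>n\<in>UNIV. \<forall>y\<in>cball x d. norm (theta_term n z y) \<le> M n)"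
    using M 1 2 3 x by (intro exI[of _ "Re x / 2"] exI[of _ M]) auto
qed (auto simp: theta_term_def intro!: holomorphic_intros)

section \<open>Fourier series and Poisson summation\<close>

lemma sum_symmetric_interval_Suc:
  fixes f :: "int \<Rightarrow> 'a :: comm_monoid_add"
  shows "sum f {-int (Suc N)..int (Suc N)} = f (- int N - 1) + (f (int N + 1) + sum f {-int N..int N})"
proof -
  have "{-int (Suc N)..int (Suc N)} = insert (- int N - 1) (insert (int N + 1) {-int N..int N})" by auto
  then show ?thesis by simp
qed

lemma filterlim_symmetric_intervals:
  "filterlim (\<lambda>N. {-int N..int N}) (finite_subsets_at_top UNIV) sequentially"
  unfolding filterlim_finite_subsets_at_top
proof (intro allI impI)
  fix X :: "int set" assume X: "finite X \<and> X \<subseteq> UNIV"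
  then obtain B where B: "\<And>x. x \<in> X \<Longrightarrow> \<bar>x\<bar> \<le> B"
    using finite_imageI[of X abs] by (metis Max_ge image_eqI)
  show "\<forall>\<^sub>F N in sequentially. finite {-int N..int N} \<and> X \<subseteq> {-int N..int N} \<and> {-int N..int N} \<subseteq> UNIV"
    using eventually_ge_at_top[of "nat B"]
  proof eventually_elim
    case (elim N)
    have "x \<in> {-int N..int N}" if "x \<in> X" for x using B[OF that] elim by auto
    then show ?case by auto
  qed
qed

text \<open>Integration by parts. The bound is made of the integral of the derivative and of the two
  boundary values, which in general do not cancel because U need not be periodic.\<close>

lemma fourier_coeff_bound:
  assumes "open S" and hol: "U holomorphic_on S" and I: "of_real ` {-1/2..1/2::real} \<subseteq> S"
  shows "\<exists>B. \<forall>m::int. norm (2 * pi * of_int m * integral {-1/2..1/2} (\<lambda>x. U (of_real x) * exp (- 2 * pi * \<i> * of_int m * of_real x))) \<le> B"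
proof -
  let ?I = "{-1/2..1/2::real}"
  have cU: "continuous_on ?I (\<lambda>x. U (of_real x))"
    by (rule continuous_on_compose2[OF holomorphic_on_imp_continuous_on[OF hol] _ I]) (intro continuous_intros)
  have cU': "continuous_on ?I (\<lambda>x. deriv U (of_real x))"
    by (rule continuous_on_compose2[OF holomorphic_on_imp_continuous_on[OF holomorphic_deriv[OF hol \<open>open S\<close>]] _ I])
       (intro continuous_intros)
  obtain B1 where B1: "\<forall>x\<in>?I. norm (deriv U (of_real x)) \<le> B1"
    using compact_imp_bounded[OF compact_continuous_image[OF cU']] by (auto simp: bounded_iff)
  obtain B2 where B2: "\<forall>x\<in>?I. norm (U (of_real x)) \<le> B2"
    using compact_imp_bounded[OF compact_continuous_image[OF cU]] by (auto simp: bounded_iff)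
  have "norm (2 * pi * of_int m * integral ?I (\<lambda>x. U (of_real x) * exp (- 2 * pi * \<i> * of_int m * of_real x))) \<le> B1 + 2 * B2" for m :: int
  proof -
    define a where "a = - 2 * pi * \<i> * of_int m"
    have na: "norm (exp (a * of_real x)) = 1" for x :: real
      unfolding a_def norm_exp_eq_Re by simp
    let ?E = "\<lambda>x. exp (a * complex_of_real x)"
    have cE: "continuous_on ?I ?E" by (intro continuous_intros)
    have "((\<lambda>x. deriv U (of_real x) * ?E x + a * (U (of_real x) * ?E x)) has_integral
        U (of_real (1/2)) * ?E (1/2) - U (of_real (-1/2)) * ?E (-1/2)) ?I"
    proof (rule fundamental_theorem_of_calculus)
      fix x :: real assume x: "x \<in> ?I"
      have "of_real x \<in> S" using I x by blast
      then have "(U has_field_derivative deriv U (of_real x)) (at (of_real x))"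
        by (rule holomorphic_derivI[OF hol \<open>open S\<close>])
      then have "((\<lambda>z. U z * exp (a * z)) has_field_derivative
          deriv U (of_real x) * ?E x + a * (U (of_real x) * ?E x)) (at (of_real x))"
        by (auto intro!: derivative_eq_intros)
      then show "((\<lambda>x. U (of_real x) * ?E x) has_vector_derivative
          deriv U (of_real x) * ?E x + a * (U (of_real x) * ?E x)) (at x within ?I)"
        by (intro has_vector_derivative_at_within[OF has_vector_derivative_real_field])
    qed simp
    then have "integral ?I (\<lambda>x. deriv U (of_real x) * ?E x + a * (U (of_real x) * ?E x))
        = U (of_real (1/2)) * ?E (1/2) - U (of_real (-1/2)) * ?E (-1/2)"
      by (rule integral_unique)
    moreover have "integral ?I (\<lambda>x. deriv U (of_real x) * ?E x + a * (U (of_real x) * ?E x))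
        = integral ?I (\<lambda>x. deriv U (of_real x) * ?E x) + a * integral ?I (\<lambda>x. U (of_real x) * ?E x)"
    proof (subst integral_add)
      show "(\<lambda>x. a * (U (of_real x) * ?E x)) integrable_on ?I"
        by (intro integrable_continuous_interval continuous_intros cU cE)
    qed (use cU cU' cE in \<open>auto intro!: integrable_continuous_interval continuous_intros\<close>)
    ultimately have eq: "a * integral ?I (\<lambda>x. U (of_real x) * ?E x)
        = U (of_real (1/2)) * ?E (1/2) - U (of_real (-1/2)) * ?E (-1/2) - integral ?I (\<lambda>x. deriv U (of_real x) * ?E x)"
      by (simp add: algebra_simps)
    have "norm (integral ?I (\<lambda>x. deriv U (of_real x) * ?E x)) \<le> B1 * (1/2 - (-1/2))"
    proof (rule integral_bound)
      show "continuous_on ?I (\<lambda>x. deriv U (of_real x) * ?E x)" by (intro continuous_intros cU' cE)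
      show "norm (deriv U (of_real x) * ?E x) \<le> B1" if "x \<in> ?I" for x
        unfolding norm_mult na using B1 that by simp
    qed simp
    then have n1: "norm (integral ?I (\<lambda>x. deriv U (of_real x) * ?E x)) \<le> B1" by simp
    have n2: "norm (U (of_real (1/2)) * ?E (1/2)) \<le> B2" "norm (U (of_real (-1/2)) * ?E (-1/2)) \<le> B2"
      unfolding norm_mult na using B2[rule_format, of "1/2"] B2[rule_format, of "-1/2"] by simp_all
    have tri: "norm (p - r - t) \<le> B1 + 2 * B2" if "norm t \<le> B1" "norm p \<le> B2" "norm r \<le> B2" for p r t :: complex
      using that norm_triangle_ineq4[of p r] norm_triangle_ineq4[of "p - r" t] by linarith
    have "norm (a * integral ?I (\<lambda>x. U (of_real x) * ?E x)) \<le> B1 + 2 * B2"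
      unfolding eq by (rule tri[OF n1 n2])
    moreover have "norm (a * J) = norm (2 * pi * of_int m * J)" for J :: complex
      by (simp add: a_def norm_mult abs_mult)
    ultimately show ?thesis unfolding a_def by metis
  qed
  then show ?thesis by blast
qed

lemma fourier_coeff_tendsto_0:
  assumes "open S" and hol: "U holomorphic_on S" and I: "of_real ` {-1/2..1/2::real} \<subseteq> S"
    and f: "filterlim (\<lambda>n. \<bar>real_of_int (f n)\<bar>) at_top sequentially"
  shows "(\<lambda>n. integral {-1/2..1/2} (\<lambda>x. U (of_real x) * exp (- 2 * pi * \<i> * of_int (f n) * of_real x))) \<longlonglongrightarrow> 0"
proof -
  let ?c = "\<lambda>m::int. integral {-1/2..1/2} (\<lambda>x. U (of_real x) * exp (- 2 * pi * \<i> * of_int m * of_real x))"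
  obtain B where B: "\<forall>m::int. norm (2 * pi * of_int m * ?c m) \<le> B"
    using fourier_coeff_bound[OF assms(1-3)] by blast
  have b: "norm (?c m) \<le> B / \<bar>real_of_int m\<bar>" if "\<bar>real_of_int m\<bar> > 0" for m
  proof -
    have "2 * pi * (\<bar>real_of_int m\<bar> * norm (?c m)) \<le> B"
      using B[rule_format, of m] by (simp add: norm_mult)
    moreover have "1 * (\<bar>real_of_int m\<bar> * norm (?c m)) \<le> 2 * pi * (\<bar>real_of_int m\<bar> * norm (?c m))"
      using pi_gt3 by (intro mult_right_mono) auto
    ultimately have "norm (?c m) * \<bar>real_of_int m\<bar> \<le> B" by (simp only: mult.commute mult_1_right)
    then show ?thesis by (simp only: pos_le_divide_eq[OF that])
  qed
  have "(\<lambda>n. B / \<bar>real_of_int (f n)\<bar>) \<longlonglongrightarrow> 0"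
    by (rule tendsto_divide_0[OF tendsto_const]) (rule filterlim_at_top_imp_at_infinity[OF f])
  moreover have "\<forall>\<^sub>F n in sequentially. norm (?c (f n)) \<le> B / \<bar>real_of_int (f n)\<bar>"
    using filterlim_at_top_dense[THEN iffD1, OF f, rule_format, of 0] by eventually_elim (rule b)
  ultimately show ?thesis by (rule Lim_null_comparison[rotated])
qed

lemma integral_exp_int:
  "integral {-1/2..1/2} (\<lambda>x::real. exp (- 2 * pi * \<i> * of_int m * of_real x)) = (if m = 0 then 1 else 0)"
proof (cases "m = 0")
  case False
  define a where "a = - 2 * pi * \<i> * of_int m"
  have a: "a \<noteq> 0" using False by (simp add: a_def)
  have "((\<lambda>x::real. exp (a * of_real x)) has_integral exp (a * of_real (1/2)) / a - exp (a * of_real (-1/2)) / a) {-1/2..1/2}"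
  proof (rule fundamental_theorem_of_calculus)
    fix x :: real
    have "((\<lambda>z. exp (a * z) / a) has_field_derivative exp (a * of_real x)) (at (of_real x))"
      using a by (auto intro!: derivative_eq_intros)
    then show "((\<lambda>x. exp (a * of_real x) / a) has_vector_derivative exp (a * of_real x)) (at x within {-1/2..1/2})"
      by (intro has_vector_derivative_at_within[OF has_vector_derivative_real_field])
  qed simp
  moreover have "exp (a * of_real (1/2)) = exp (a * of_real (-1/2))"
    unfolding a_def exp_eq by (rule exI[of _ "- m"]) (simp add: algebra_simps)
  ultimately show ?thesis using False unfolding a_def by (simp add: integral_unique)
qed simp

text \<open>Chernoff's argument: if \<open>h - h 0\<close> is divided by \<open>e\<^bsup>2\<pi>iz\<^esup> - 1\<close>, the partial sums of the Fourier series
  telescope to \<open>h 0\<close> plus two Fourier coefficients of the quotient, which tend to \<open>0\<close>.\<close>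

lemma fourier_series_at_0:
  fixes h :: "complex \<Rightarrow> complex"
  assumes h: "h holomorphic_on UNIV"
  shows "(\<lambda>N. \<Sum>m\<in>{-int N..int N}. integral {-1/2..1/2} (\<lambda>x. h (of_real x) * exp (- 2 * pi * \<i> * of_int m * of_real x))) \<longlonglongrightarrow> h 0"
proof -
  let ?I = "{-1/2..1/2::real}"
  let ?c = "\<lambda>m::int. integral ?I (\<lambda>x. h (of_real x) * exp (- 2 * pi * \<i> * of_int m * of_real x))"
  define e where "e z = exp (2 * pi * \<i> * z) - 1" for z :: complex
  \<comment> \<open>The zeros of \<open>e\<close> are the integers; the strip contains the segment
    of integration but no zero other than 0.\<close>
  define S where "S = {z. Re z < 1} \<inter> {z. Re z > -1}"
  \<comment> \<open>The value at 0 is the limit of the quotient, as \<open>e\<close> has derivative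
    2 \<pi> \<i> there; the singularity is thus removable.\<close>
  define U where "U z = (if z = 0 then deriv h 0 / (2 * pi * \<i>) else (h z - h 0) / e z)" for z
  have S: "open S" unfolding S_def by (intro open_Int open_halfspace_Re_lt open_halfspace_Re_gt)
  have e0: "e z \<noteq> 0" if z: "z \<in> S" "z \<noteq> 0" for z
  proof
    assume "e z = 0"
    then obtain n :: int where n: "Im z = 0" "Re z = of_int n"
      by (auto simp: e_def exp_eq_1)
    then have "n = 0" using z(1) by (simp add: S_def)
    then show False using n z(2) by (simp add: complex_eq_iff)
  qed
  have hd: "(h has_field_derivative deriv h z) (at z)" for z
    using holomorphic_derivI[OF h] by simp
  have ed: "(e has_field_derivative 2 * pi * \<i> * exp (2 * pi * \<i> * z)) (at z)" for z
    unfolding e_def by (auto intro!: derivative_eq_intros)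
  have hol0: "(\<lambda>z. (h z - h 0) / e z) holomorphic_on S - {0}"
    by (intro holomorphic_intros holomorphic_on_subset[OF h]) (use e0 in \<open>auto simp: e_def intro!: holomorphic_intros\<close>)
  then have hol1: "U holomorphic_on S - {0}"
    by (rule holomorphic_transform) (simp add: U_def)
  have "U holomorphic_on S"
  proof (rule no_isolated_singularity[OF _ hol1 S])
    show "continuous_on S U"
      unfolding continuous_on_eq_continuous_at[OF S]
    proof
      fix z assume z: "z \<in> S"
      show "isCont U z"
      proof (cases "z = 0")
        case True
        have "((\<lambda>z. ((h z - h 0) / (z - 0)) / ((e z - e 0) / (z - 0))) \<longlongrightarrow> deriv h 0 / (2 * pi * \<i>)) (at 0)"
          by (rule tendsto_divide) (use hd[of 0] ed[of 0] in \<open>auto simp: has_field_derivative_iff\<close>)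
        then have "(U \<longlongrightarrow> deriv h 0 / (2 * pi * \<i>)) (at 0)"
          by (rule Lim_transform_eventually) (auto simp: U_def e_def eventually_at_filter)
        moreover have "U 0 = deriv h 0 / (2 * pi * \<i>)" by (simp add: U_def)
        ultimately show ?thesis unfolding True isCont_def by (simp only:)
      next
        case False
        then show ?thesis
          using z S holomorphic_on_imp_continuous_on[OF hol1] by (simp add: continuous_on_eq_continuous_at open_Diff)
      qed
    qed
  qed simp
  have IS: "of_real ` ?I \<subseteq> S" by (auto simp: S_def)
  define u where "u m = integral ?I (\<lambda>x. U (of_real x) * exp (- 2 * pi * \<i> * of_int m * of_real x))" for m :: int
  have cU: "continuous_on ?I (\<lambda>x. U (of_real x))"
    by (rule continuous_on_compose2[OF holomorphic_on_imp_continuous_on[OF \<open>U holomorphic_on S\<close>] _ IS])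
       (intro continuous_intros)
  \<comment> \<open>Multiplication by e^(2 \<pi> \<i> x) shifts the frequency by one, so the
    coefficients of the product of \<open>U\<close> and \<open>e\<close> are differences of
    neighbouring coefficients of \<open>U\<close>. The constant h 0 is seen only at m = 0.\<close>
  have c: "?c m = (if m = 0 then h 0 else 0) + u (m - 1) - u m" for m
  proof -
    let ?E = "\<lambda>m x. exp (- 2 * pi * \<i> * of_int m * complex_of_real x)"
    have "?c m = integral ?I (\<lambda>x. (h 0 * ?E m x + U (of_real x) * ?E (m - 1) x) - U (of_real x) * ?E m x)"
    proof (rule integral_cong)
      fix x assume x: "x \<in> ?I"
      have "h (of_real x) = h 0 + U (of_real x) * e (of_real x)"
      proof -
        have "of_real x \<in> S" using IS x by blast
        then show ?thesis using e0[of "of_real x"] by (auto simp: U_def e_def)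
      qed
      moreover have "?E (m - 1) x = exp (2 * pi * \<i> * of_real x) * ?E m x"
        unfolding exp_add[symmetric] by (simp add: algebra_simps)
      moreover have "(a + v * (p - 1)) * E = (a * E + v * (p * E)) - v * E" for a v p E :: complex
        by (simp add: algebra_simps)
      ultimately show "h (of_real x) * ?E m x = (h 0 * ?E m x + U (of_real x) * ?E (m - 1) x) - U (of_real x) * ?E m x"
        unfolding e_def by (simp only:)
    qed
    also have "\<dots> = integral ?I (\<lambda>x. h 0 * ?E m x) + u (m - 1) - u m"
      unfolding u_def
      by (subst integral_diff integral_add; (intro integrable_continuous_interval continuous_intros cU)?)+ simp
    also have "integral ?I (\<lambda>x. h 0 * ?E m x) = (if m = 0 then h 0 else 0)"
      using integral_exp_int[of m] by simp
    finally show ?thesis .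
  qed
  have tel: "(\<Sum>m\<in>{-int N..int N}. ?c m) = h 0 + u (- int N - 1) - u (int N)" for N
  proof (induction N)
    case (Suc N)
    have c1: "?c (- int N - 1) = u (- int (Suc N) - 1) - u (- int N - 1)"
      using c[of "- int N - 1"] by (simp add: algebra_simps)
    have c2: "?c (int N + 1) = u (int N) - u (int (Suc N))"
      using c[of "int N + 1"] by (simp add: algebra_simps)
    show ?case unfolding sum_symmetric_interval_Suc Suc.IH c1 c2 by (simp only: algebra_simps)
  qed (use c[of 0] in simp)
  have "(\<lambda>N. h 0 + u (- int N - 1) - u (int N)) \<longlonglongrightarrow> h 0 + 0 - 0"
    unfolding u_def
  proof (intro tendsto_intros fourier_coeff_tendsto_0[OF S \<open>U holomorphic_on S\<close> IS])
    show "filterlim (\<lambda>n. \<bar>real_of_int (- int n - 1)\<bar>) at_top sequentially" by real_asymp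
    show "filterlim (\<lambda>n. \<bar>real_of_int (int n)\<bar>) at_top sequentially" by real_asymp
  qed
  then show ?thesis unfolding tel by simp
qed

text \<open>Substituting c (x + b) with c = sqrt (2 \<pi> w) reduces this to the characteristic
  function of the standard normal distribution; the shift by b becomes the phase.\<close>

lemma gaussian_fourier:
  fixes w s b :: real
  assumes w: "0 < w"
  defines "G \<equiv> \<lambda>t::real. exp (- (of_real pi * of_real w * (of_real t + of_real b)\<^sup>2)) * exp (- 2 * pi * \<i> * s * of_real t)"
  shows "integrable lborel G"
    and "integral\<^sup>L lborel G = exp (2 * pi * \<i> * s * b) * exp (- (of_real pi * of_real s ^ 2 / of_real w)) / of_real (sqrt w)"
proof -
  define c where "c = sqrt (2 * pi * w)"
  have c: "c > 0" "c\<^sup>2 = 2 * pi * w" using w by (simp_all add: c_def)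
  define t where "t = - (2 * pi * s / c)"
  let ?f = "\<lambda>x. std_normal_density x *\<^sub>R iexp (t * x)"
  have int: "integrable lborel ?f"
  proof (rule Bochner_Integration.integrable_bound)
    show "integrable lborel std_normal_density" by simp
    show "AE x in lborel. norm (?f x) \<le> norm (std_normal_density x)" by simp
  qed measurable
  have "integral\<^sup>L lborel ?f = char std_normal_distribution t"
    unfolding char_def by (subst integral_density) auto
  then have val: "integral\<^sup>L lborel ?f = of_real (exp (- (t^2) / 2))"
    unfolding char_std_normal_distribution .
  have f: "?f (c * b + c * x) = of_real (1 / sqrt (2 * pi)) * exp (- 2 * pi * \<i> * s * b) * G x" for x
  proof -
    have "(c * b + c * x)\<^sup>2 / 2 = pi * w * (x + b)\<^sup>2"
    proof -
      have "c * b + c * x = c * (x + b)" by (simp add: algebra_simps)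
      then show ?thesis by (simp add: power_mult_distrib c(2))
    qed
    then have "std_normal_density (c * b + c * x) = 1 / sqrt (2 * pi) * exp (- (pi * w * (x + b)\<^sup>2))"
      unfolding std_normal_density_def by simp
    then have 1: "complex_of_real (std_normal_density (c * b + c * x))
        = of_real (1 / sqrt (2 * pi)) * exp (- (of_real pi * of_real w * (of_real x + of_real b)\<^sup>2))"
      by (simp add: exp_of_real[symmetric])
    have arg: "t * (c * b + c * x) = - 2 * pi * s * b + - 2 * pi * s * x"
      using c(1) by (simp add: t_def field_simps)
    have "\<i> * complex_of_real (t * (c * b + c * x)) = - 2 * pi * \<i> * s * b + - 2 * pi * \<i> * s * x"
      unfolding arg by (simp add: algebra_simps)
    then have 2: "iexp (t * (c * b + c * x)) = exp (- 2 * pi * \<i> * s * b) * exp (- 2 * pi * \<i> * s * x)"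
      by (simp only: exp_add)
    show ?thesis
      unfolding G_def scaleR_conv_of_real 1 2 by (simp only: mult_ac)
  qed
  let ?K = "of_real (1 / sqrt (2 * pi)) * exp (- 2 * pi * \<i> * s * b) :: complex"
  have K: "?K \<noteq> 0" by simp
  have "integrable lborel (\<lambda>x. ?f (c * b + c * x))"
    using c(1) by (intro lborel_integrable_real_affine int) simp
  then have "integrable lborel (\<lambda>x. ?K * G x)" unfolding f .
  then have "integrable lborel (\<lambda>x. inverse ?K * (?K * G x))" by (rule integrable_mult_right)
  moreover have "inverse ?K * (?K * G x) = G x" for x
    using left_inverse[OF K] by (metis mult.assoc mult_1_left)
  ultimately show "integrable lborel G" by (simp only:)
  have "integral\<^sup>L lborel ?f = \<bar>c\<bar> *\<^sub>R integral\<^sup>L lborel (\<lambda>x. ?f (c * b + c * x))"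
    by (rule lborel_integral_real_affine) (use c(1) in simp)
  also have "\<dots> = of_real c * (?K * integral\<^sup>L lborel G)"
    unfolding f using c(1) by (simp add: scaleR_conv_of_real)
  also have "of_real c * (?K * integral\<^sup>L lborel G) = of_real (sqrt w) * exp (- 2 * pi * \<i> * s * b) * integral\<^sup>L lborel G"
  proof -
    have "c * (1 / sqrt (2 * pi)) = sqrt w" using w by (simp add: c_def real_sqrt_mult)
    then have "complex_of_real c * of_real (1 / sqrt (2 * pi)) = of_real (sqrt w)" by (metis of_real_mult)
    then show ?thesis by (simp only: mult.assoc[symmetric])
  qed
  finally have val': "of_real (sqrt w) * exp (- 2 * pi * \<i> * s * b) * integral\<^sup>L lborel G = of_real (exp (- (t^2) / 2))"
    unfolding val by (rule sym)
  have arg: "- (t^2) / 2 = - (pi * s ^ 2 / w)"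
    unfolding t_def using w c(2) by (simp add: power_divide power_mult_distrib) (simp add: field_simps power2_eq_square)
  have E: "of_real (sqrt w) * exp (- 2 * pi * \<i> * s * b) * integral\<^sup>L lborel G = exp (- (of_real pi * of_real s ^ 2 / of_real w))"
    unfolding val' arg by (simp add: exp_of_real[symmetric])
  have one: "exp (2 * pi * \<i> * s * b) * exp (- 2 * pi * \<i> * s * b) = (1 :: complex)"
    by (simp add: exp_add[symmetric])
  have sw: "complex_of_real (sqrt w) \<noteq> 0" using w by simp
  have "of_real (sqrt w) * integral\<^sup>L lborel G
      = (exp (2 * pi * \<i> * s * b) * exp (- 2 * pi * \<i> * s * b)) * (of_real (sqrt w) * integral\<^sup>L lborel G)"
    unfolding one by simp
  also have "\<dots> = exp (2 * pi * \<i> * s * b) * exp (- (of_real pi * of_real s ^ 2 / of_real w))"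
    unfolding E[symmetric] by (simp only: mult_ac)
  finally show "integral\<^sup>L lborel G = exp (2 * pi * \<i> * s * b) * exp (- (of_real pi * of_real s ^ 2 / of_real w)) / of_real (sqrt w)"
    using sw by (simp only: nonzero_eq_divide_eq mult.commute not_False_eq_True)
qed

text \<open>Integer translates of the unit interval tile growing symmetric intervals, and dominated
  convergence passes from these to the whole line.\<close>

lemma integral_over_unit_intervals:
  fixes G :: "real \<Rightarrow> complex"
  assumes G: "continuous_on UNIV G" "integrable lborel G"
  shows "(\<lambda>N. \<Sum>n\<in>{-int N..int N}. integral {-1/2..1/2} (\<lambda>x. G (x + of_int n))) \<longlonglongrightarrow> integral\<^sup>L lborel G"
proof -
  have int: "G integrable_on {a..b}" for a b
    by (rule integrable_continuous_interval[OF continuous_on_subset[OF G(1)]]) simp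
  have shift: "integral {-1/2..1/2} (\<lambda>x. G (x + of_int n)) = integral {of_int n - 1/2..of_int n + 1/2} G" for n :: int
    using integral_shift_real_ivl[of "of_int n - 1/2" "of_int n" "of_int n + 1/2" G] by simp
  have tel: "(\<Sum>n\<in>{-int N..int N}. integral {-1/2..1/2} (\<lambda>x. G (x + of_int n))) = integral {- real N - 1/2..real N + 1/2} G" for N
  proof (induction N)
    case 0
    then show ?case using shift[of 0] by simp
  next
    case (Suc N)
    have ends: "real_of_int (- int N - 1) - 1/2 = - real N - 3/2" "real_of_int (- int N - 1) + 1/2 = - real N - 1/2"
      "real_of_int (int N + 1) - 1/2 = real N + 1/2" "real_of_int (int N + 1) + 1/2 = real N + 3/2" by simp_all
    have "(\<Sum>n\<in>{-int (Suc N)..int (Suc N)}. integral {-1/2..1/2} (\<lambda>x. G (x + of_int n)))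
        = integral {- real N - 3/2..- real N - 1/2} G + (integral {real N + 1/2..real N + 3/2} G + integral {- real N - 1/2..real N + 1/2} G)"
      unfolding sum_symmetric_interval_Suc Suc.IH unfolding shift ends ..
    also have "\<dots> = integral {- real N - 3/2..- real N - 1/2} G + integral {- real N - 1/2..real N + 3/2} G"
      using Henstock_Kurzweil_Integration.integral_combine[OF _ _ int, of "- real N - 1/2" "real N + 1/2" "real N + 3/2"] by (simp add: add_ac)
    also have "\<dots> = integral {- real N - 3/2..real N + 3/2} G"
      by (rule Henstock_Kurzweil_Integration.integral_combine[OF _ _ int]) auto
    finally show ?case by (simp add: algebra_simps)
  qed
  have "(\<lambda>N. integral UNIV (\<lambda>x. if x \<in> {- real N - 1/2..real N + 1/2} then G x else 0)) \<longlonglongrightarrow> integral UNIV G"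
  proof (rule dominated_convergence(2))
    show "(\<lambda>x. norm (G x)) integrable_on UNIV"
      using integrable_on_lborel[of "\<lambda>x. norm (G x)"] integrable_norm[OF G(2)] by blast
    show "(\<lambda>x. if x \<in> {- real N - 1/2..real N + 1/2} then G x else 0) integrable_on UNIV" for N
      unfolding integrable_restrict_UNIV by (rule int)
    show "(\<lambda>N. if x \<in> {- real N - 1/2..real N + 1/2} then G x else 0) \<longlonglongrightarrow> G x" for x
    proof (rule tendsto_eventually)
      show "\<forall>\<^sub>F N in sequentially. (if x \<in> {- real N - 1/2..real N + 1/2} then G x else 0) = G x"
        using eventually_ge_at_top[of "nat \<lceil>\<bar>x\<bar>\<rceil>"]
      proof eventually_elim
        case (elim N)
        then have "\<bar>x\<bar> \<le> real N" by linarith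
        then show ?case by auto
      qed
    qed
  qed auto
  then show ?thesis
    unfolding tel integral_restrict_UNIV integral_lborel[OF G(2)] .
qed

text \<open>The factor e^(- \<pi> \<i> x) undoes the antiperiodicity of \<open>theta\<close>:
  translation by n changes the exponential of frequency m + 1/2 by the sign (-1)^n of the term. All
  terms are therefore translates of one function \<open>G\<close>, and the coefficient unfolds to
  its integral over the line.\<close>

lemma theta_fourier_coeff:
  fixes w b :: real and m :: int
  assumes w: "0 < w"
  shows "integral {-1/2..1/2} (\<lambda>x. theta (of_real b + of_real x) (of_real w) * exp (- pi * \<i> * of_real x) * exp (- 2 * pi * \<i> * of_int m * of_real x))
    = exp (2 * pi * \<i> * (of_int m + 1/2) * b) * exp (- (of_real pi * (of_int m + 1/2) ^ 2 / of_real w)) / of_real (sqrt w)"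
proof -
  let ?I = "{-1/2..1/2::real}"
  let ?E = "\<lambda>x::real. exp (- pi * \<i> * of_real x) * exp (- 2 * pi * \<i> * of_int m * of_real x)"
  define g where "g n x = theta_term n (of_real b + of_real x) (of_real w) * ?E x" for n and x :: real
  define s where "s = real_of_int m + 1/2"
  define G where "G = (\<lambda>t::real. exp (- (of_real pi * of_real w * (of_real t + of_real b)\<^sup>2)) * exp (- 2 * pi * \<i> * s * of_real t) :: complex)"
  have gG: "g n x = G (x + of_int n)" for n x
  proof -
    have pp: "(-1::complex) powi n * (-1) powi n = 1"
      by (simp add: power_int_mult_distrib[symmetric])
    have E: "?E x = (-1) powi n * exp (- 2 * pi * \<i> * s * of_real (x + of_int n))"
    proof -
      have "exp (- 2 * pi * \<i> * s * of_real (x + of_int n))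
          = exp (- 2 * pi * \<i> * s * of_real x + - (pi * \<i> * of_int n))"
        unfolding exp_eq by (rule exI[of _ "- (n * m)"]) (simp add: s_def algebra_simps)
      also have "\<dots> = exp (- 2 * pi * \<i> * s * of_real x) * exp (- (pi * \<i> * of_int n))"
        by (rule exp_add)
      also have "exp (- (pi * \<i> * of_int n)) = ((-1) powi n :: complex)"
      proof -
        have "exp (- (pi * \<i> * of_int n)) = exp (- (pi * \<i>)) powi n"
          by (simp add: exp_power_int mult_ac)
        then show ?thesis by (simp add: exp_minus)
      qed
      finally have 1: "exp (- 2 * pi * \<i> * s * of_real (x + of_int n)) = exp (- 2 * pi * \<i> * s * of_real x) * ((-1) powi n :: complex)" .
      from pp have "(-1) powi n * (exp (- 2 * pi * \<i> * s * of_real (x + of_int n)) :: complex) = exp (- 2 * pi * \<i> * s * of_real x)"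
        unfolding 1 mult.left_commute[of "(-1) powi n"] by (simp only: mult_1_right)
      also have "\<dots> = ?E x"
      proof -
        have "- 2 * pi * \<i> * s * of_real x = - pi * \<i> * of_real x + - 2 * pi * \<i> * of_int m * of_real x"
          by (simp add: s_def algebra_simps)
        then show ?thesis by (simp only: exp_add)
      qed
      finally show ?thesis by (rule sym)
    qed
    have arg: "of_int n + (complex_of_real b + of_real x) = of_real (x + of_int n) + of_real b" by simp
    have "p * u * (p * v) = u * v" if "p * p = 1" for p u v :: complex
    proof -
      have "p * u * (p * v) = (p * p) * (u * v)" by (simp only: mult_ac)
      then show ?thesis using that by simp
    qed
    then show ?thesis
      unfolding g_def theta_term_def G_def E arg using pp by blast
  qed
  have cG: "continuous_on UNIV G" unfolding G_def by (intro continuous_intros)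
  obtain M where M: "M summable_on (UNIV :: int set)"
    "\<forall>n z' w'. w \<le> Re w' \<longrightarrow> norm w' \<le> w \<longrightarrow> norm z' \<le> \<bar>b\<bar> + 1 \<longrightarrow> norm (theta_term n z' w') \<le> M n"
    using theta_term_bound[OF w] by blast
  have gM: "norm (g n x) \<le> M n" if "x \<in> ?I" for n x
  proof -
    have "norm (complex_of_real b + of_real x) \<le> \<bar>b\<bar> + 1"
      using that norm_triangle_ineq[of "complex_of_real b" "of_real x"] by (simp add: abs_if split: if_splits)
    then have "norm (theta_term n (of_real b + of_real x) (of_real w)) \<le> M n"
      using M(2)[rule_format, of "of_real w"] w by simp
    moreover have "norm (?E x) = 1" unfolding norm_mult norm_exp_eq_Re by simp
    ultimately show ?thesis unfolding g_def norm_mult[of _ "?E x"] by simp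
  qed
  have ul: "uniform_limit ?I (\<lambda>X x. \<Sum>n\<in>X. g n x) (\<lambda>x. \<Sum>\<^sub>\<infinity>n. g n x) (finite_subsets_at_top UNIV)"
    by (rule Weierstrass_m_test_general[OF gM M(1)])
  have cg: "continuous_on ?I (\<lambda>x. \<Sum>n\<in>X. g n x)" for X
    unfolding gG by (intro continuous_on_sum continuous_on_compose2[OF cG]) (auto intro!: continuous_intros)
  \<comment> \<open>Uniform convergence on the compact interval justifies integration term by
    term.\<close>
  have "\<exists>Ig J. (\<forall>X. ((\<lambda>x. \<Sum>n\<in>X. g n x) has_integral Ig X) ?I) \<and>
      ((\<lambda>x. \<Sum>\<^sub>\<infinity>n. g n x) has_integral J) ?I \<and> (Ig \<longlongrightarrow> J) (finite_subsets_at_top UNIV)"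
    by (rule uniform_limit_integral[OF ul cg finite_subsets_at_top_neq_bot]) blast
  then obtain Ig J where Ig: "\<And>X. ((\<lambda>x. \<Sum>n\<in>X. g n x) has_integral Ig X) ?I"
    and J: "((\<lambda>x. \<Sum>\<^sub>\<infinity>n. g n x) has_integral J) ?I" and lim: "(Ig \<longlongrightarrow> J) (finite_subsets_at_top UNIV)"
    by blast
  have IgN: "Ig {-int N..int N} = (\<Sum>n\<in>{-int N..int N}. integral ?I (\<lambda>x. G (x + of_int n)))" for N
  proof -
    have "((\<lambda>x. \<Sum>n\<in>{-int N..int N}. g n x) has_integral (\<Sum>n\<in>{-int N..int N}. integral ?I (\<lambda>x. G (x + of_int n)))) ?I"
      unfolding gG
      by (intro has_integral_sum integrable_integral integrable_continuous_interval continuous_on_compose2[OF cG])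
         (auto intro!: continuous_intros)
    then show ?thesis using Ig has_integral_unique by blast
  qed
  have "(\<lambda>N. Ig {-int N..int N}) \<longlonglongrightarrow> J"
    by (rule filterlim_compose[OF lim filterlim_symmetric_intervals])
  moreover have "(\<lambda>N. Ig {-int N..int N}) \<longlonglongrightarrow> integral\<^sup>L lborel G"
    unfolding IgN by (rule integral_over_unit_intervals[OF cG]) (use gaussian_fourier(1)[OF w, of b s] in \<open>simp add: G_def\<close>)
  ultimately have "J = integral\<^sup>L lborel G" by (rule LIMSEQ_unique)
  moreover have "(\<Sum>\<^sub>\<infinity>n. g n x) = theta (of_real b + of_real x) (of_real w) * ?E x" for x
    unfolding g_def theta_def using theta_term_summable[of "of_real w"] w by (subst infsum_cmult_left) auto
  ultimately have "integral ?I (\<lambda>x. theta (of_real b + of_real x) (of_real w) * ?E x) = integral\<^sup>L lborel G"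
    using J integral_unique by simp
  then show ?thesis
    unfolding G_def gaussian_fourier(2)[OF w] s_def by (simp add: mult.assoc)
qed

text \<open>This is the Fourier series of e^(- \<pi> \<i> x) \<open>theta\<close> (b + x) at x = 0.
  Its convergence is known along symmetric partial sums; absolute summability of the coefficients
  turns it into an unordered sum, which may be regrouped.\<close>

lemma theta_poisson:
  fixes w b :: real
  assumes w: "0 < w"
  shows "((\<lambda>m::int. exp (2 * pi * \<i> * (of_int m + 1/2) * b) * exp (- (of_real pi * (of_int m + 1/2) ^ 2 / of_real w)) / of_real (sqrt w))
      has_sum theta (of_real b) (of_real w)) UNIV"
proof -
  let ?c = "\<lambda>m::int. exp (2 * pi * \<i> * (of_int m + 1/2) * b) * exp (- (of_real pi * (of_int m + 1/2) ^ 2 / of_real w)) / complex_of_real (sqrt w)"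
  \<comment> \<open>In absolute value the coefficients are theta terms again, at z = 1/2 and
    1/w.\<close>
  have nc: "norm (?c m) = norm (theta_term m (1/2) (1 / of_real w)) / sqrt w" for m
  proof -
    have 1: "norm (exp (2 * pi * \<i> * (of_int m + 1/2) * b)) = 1" by simp
    have 2: "norm (theta_term m (1/2) (1 / of_real w)) = norm (exp (- (of_real pi * (of_int m + 1/2) ^ 2 / complex_of_real w)))"
      unfolding theta_term_def norm_mult by (simp add: norm_power_int)
    show ?thesis unfolding norm_divide norm_mult 1 2 using w by simp
  qed
  have "(\<lambda>m. norm (?c m)) summable_on UNIV"
    unfolding nc unfolding divide_inverse
    by (intro summable_on_cmult_left theta_term_abs_summable) (use w in \<open>simp add: Re_divide power2_eq_square\<close>)
  then have "?c summable_on UNIV" by (rule abs_summable_summable)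
  then have S: "(?c has_sum infsum ?c UNIV) UNIV" by simp
  then have 1: "(\<lambda>N. sum ?c {-int N..int N}) \<longlonglongrightarrow> infsum ?c UNIV"
    unfolding has_sum_def by (rule filterlim_compose[OF _ filterlim_symmetric_intervals])
  let ?h = "\<lambda>z. theta (of_real b + z) (of_real w) * exp (- pi * \<i> * z)"
  have "?h holomorphic_on UNIV"
  proof (intro holomorphic_intros)
    have "(\<lambda>z. theta z (of_real w)) \<circ> (\<lambda>z. of_real b + z) holomorphic_on UNIV"
      by (rule holomorphic_on_compose_gen[OF _ holomorphic_theta_left]) (use w in \<open>auto intro!: holomorphic_intros\<close>)
    then show "(\<lambda>z. theta (of_real b + z) (of_real w)) holomorphic_on UNIV" by (simp add: o_def)
  qed
  from fourier_series_at_0[OF this] have 2: "(\<lambda>N. sum ?c {-int N..int N}) \<longlonglongrightarrow> ?h 0"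
    unfolding theta_fourier_coeff[OF w] .
  have "infsum ?c UNIV = theta (of_real b) (of_real w)"
    using LIMSEQ_unique[OF 1 2] by simp
  then show ?thesis using S by simp
qed

section \<open>Residue classes and the inversion formula\<close>

lemma has_sum_residue_classes:
  fixes f :: "int \<Rightarrow> 'a :: {topological_comm_monoid_add, t3_space}"
  assumes K: "0 < K" and f: "(f has_sum S) UNIV"
    and g: "\<And>j. j < K \<Longrightarrow> ((\<lambda>n. f (int K * n + int j)) has_sum g j) UNIV"
  shows "S = (\<Sum>j<K. g j)"
proof -
  have bij: "bij_betw (\<lambda>(j, n). int K * n + int j) ({..<K} \<times> UNIV) UNIV"
    by (rule bij_betwI[where g = "\<lambda>m. (nat (m mod int K), m div int K)"])
       (use K in \<open>auto simp: nat_less_iff div_add1_eq\<close>)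
  have "((\<lambda>x. f (case x of (j, n) \<Rightarrow> int K * n + int j)) has_sum S) ({..<K} \<times> UNIV)"
    using has_sum_reindex_bij_betw[OF bij, of f S] f by simp
  then have "(g has_sum S) {..<K}"
    by (rule has_sum_SigmaD[where f = "\<lambda>x. f (case x of (j, n) \<Rightarrow> int K * n + int j)" and B = "\<lambda>_. UNIV"])
       (use g in simp)
  then show ?thesis by (metis finite_lessThan has_sum_finite has_sum_unique)
qed

text \<open>The substitution n -> -1 - n preserves the squares and flips the sign (-1)^n.\<close>

lemma theta_one_minus: "theta (1 - z) w = - theta z w"
proof -
  have "theta (1 - z) w = (\<Sum>\<^sub>\<infinity>n. theta_term (- 1 - n) (1 - z) w)"
    unfolding theta_def
    by (rule infsum_reindex_bij_betw[symmetric]) (rule bij_betwI[where g = "\<lambda>n. - 1 - n"]; auto)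
  also have "\<dots> = (\<Sum>\<^sub>\<infinity>n. - theta_term n z w)"
  proof (rule infsum_cong)
    fix n :: int
    have "(of_int (- 1 - n) + (1 - z))\<^sup>2 = (of_int n + z)\<^sup>2"
      by (simp add: power2_eq_square algebra_simps)
    moreover have "(-1::complex) powi (- 1 - n) = - ((-1) powi n)"
      by (simp add: power_int_diff power_int_minus field_simps flip: power_int_add)
    ultimately show "theta_term (- 1 - n) (1 - z) w = - theta_term n z w"
      unfolding theta_term_def by (simp only: mult_minus_left)
  qed
  also have "\<dots> = - theta z w" unfolding theta_def by (rule infsum_uminus)
  finally show ?thesis .
qed

lemma theta_half: "theta (1/2) w = 0"
  using theta_one_minus[of "1/2" w] by simp

text \<open>The shift that absorbs the linear term of the bilateral exponent when the square is
  completed. Index k gives 1/2, where \<open>theta\<close> vanishes, and the values at i and 2 k - i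
  add up to 1.\<close>

definition theta_char :: "nat \<Rightarrow> nat \<Rightarrow> real" where
  "theta_char k i = (2 * real i + 1) / (2 * (2 * real k + 1))"

text \<open>Put m = K n + j with K = 2 k + 1. Then m + 1/2 = K (n + \<open>theta_char k j\<close>),
  so the dual Gaussian is a theta term with argument K / y, and the phase \<pi> (2 i + 1) n supplies
  its sign because 2 i + 1 is odd.\<close>

lemma theta_inversion_full:
  fixes y :: real
  assumes y: "0 < y"
  shows "theta (theta_char k i) (of_real ((2 * real k + 1) * y))
    = (\<Sum>j<2 * k + 1. exp (of_real (pi * (2 * real i + 1) * theta_char k j) * \<i>) * theta (theta_char k j) (of_real ((2 * real k + 1) / y)))
        / of_real (sqrt ((2 * real k + 1) * y))"
proof -
  define K where "K = 2 * k + 1"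
  have K: "0 < K" "real K = 2 * real k + 1" by (simp_all add: K_def)
  let ?w = "real K * y"
  have w: "0 < ?w" using K y by simp
  let ?c = "\<lambda>m::int. exp (2 * pi * \<i> * (of_int m + 1/2) * theta_char k i) * exp (- (of_real pi * (of_int m + 1/2) ^ 2 / of_real ?w)) / complex_of_real (sqrt ?w)"
  have split: "?c (int K * n + int j)
      = exp (of_real (pi * (2 * real i + 1) * theta_char k j) * \<i>) / of_real (sqrt ?w) * theta_term n (theta_char k j) (of_real (real K / y))" for n j
  proof -
    have m: "(of_int (int K * n + int j) + 1/2 :: complex) = of_nat K * (of_int n + of_real (theta_char k j))"
      unfolding theta_char_def K(2)[symmetric] using K(1) by (simp add: field_simps)
    have Kc: "complex_of_nat K \<noteq> 0" using K(1) by simp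
    have "of_real pi * (of_nat K * (of_int n + of_real (theta_char k j)))\<^sup>2 / complex_of_real ?w
        = of_real pi * of_real (real K / y) * (of_int n + of_real (theta_char k j))\<^sup>2"
      using y Kc by (simp add: power_mult_distrib power2_eq_square)
    then have 1: "exp (- (of_real pi * (of_nat K * (of_int n + of_real (theta_char k j)))\<^sup>2 / complex_of_real ?w))
        = exp (- (of_real pi * of_real (real K / y) * (of_int n + of_real (theta_char k j))\<^sup>2))"
      by (simp only:)
    have Kt: "2 * of_nat K * complex_of_real (theta_char k i) = 2 * of_nat i + 1"
    proof -
      have "2 * real K * theta_char k i = 2 * real i + 1"
        unfolding theta_char_def K(2)[symmetric] using K(1) by simp
      then have "complex_of_real (2 * real K * theta_char k i) = complex_of_real (2 * real i + 1)" by (simp only:)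
      then show ?thesis by simp
    qed
    have "2 * pi * \<i> * (of_nat K * (of_int n + of_real (theta_char k j))) * theta_char k i
        = of_real pi * \<i> * (of_int n + of_real (theta_char k j)) * (2 * of_nat K * complex_of_real (theta_char k i))"
      by (simp add: mult_ac)
    also have "\<dots> = (of_real (pi * (2 * real i + 1) * theta_char k j) * \<i> + of_int n * (of_real pi * \<i>)) + of_int (n * int i) * (2 * pi * \<i>)"
      unfolding Kt by (simp add: algebra_simps)
    finally have "exp (2 * pi * \<i> * (of_nat K * (of_int n + of_real (theta_char k j))) * theta_char k i)
        = exp (of_real (pi * (2 * real i + 1) * theta_char k j) * \<i> + of_int n * (of_real pi * \<i>))"
      unfolding exp_eq by (intro exI[of _ "n * int i"]) (simp add: algebra_simps)
    also have "\<dots> = exp (of_real (pi * (2 * real i + 1) * theta_char k j) * \<i>) * (-1) powi n"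
    proof -
      have "exp (of_int n * (of_real pi * \<i>)) = exp (of_real pi * \<i>) powi n"
        by (rule exp_power_int[symmetric])
      then show ?thesis by (simp add: exp_add)
    qed
    finally show ?thesis
      unfolding m 1 theta_term_def by simp
  qed
  have "theta (theta_char k i) (of_real ?w) = (\<Sum>j<K. exp (of_real (pi * (2 * real i + 1) * theta_char k j) * \<i>) / of_real (sqrt ?w)
      * theta (theta_char k j) (of_real (real K / y)))"
  proof (rule has_sum_residue_classes[OF K(1) theta_poisson[OF w]])
    fix j
    have "0 < Re (complex_of_real (real K / y))" using K(1) y by simp
    then have "((\<lambda>n. theta_term n (theta_char k j) (of_real (real K / y))) has_sum theta (theta_char k j) (of_real (real K / y))) UNIV"
      unfolding theta_def by (intro has_sum_infsum theta_term_summable)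
    then show "((\<lambda>n. ?c (int K * n + int j)) has_sum exp (of_real (pi * (2 * real i + 1) * theta_char k j) * \<i>) / of_real (sqrt ?w)
        * theta (theta_char k j) (of_real (real K / y))) UNIV"
      unfolding split by (rule has_sum_cmult_right)
  qed
  then show ?thesis unfolding K_def[symmetric] K(2)[symmetric] sum_divide_distrib by (simp only: times_divide_eq_left)
qed

lemma sum_fold_middle:
  fixes a :: "nat \<Rightarrow> 'a :: comm_monoid_add"
  shows "(\<Sum>j<2 * k + 1. a j) = (\<Sum>j<k. a j + a (2 * k - j)) + a k"
proof -
  have "{..<2 * k + 1} = ({..<k} \<union> {k<..2 * k}) \<union> {k}" by auto
  then have "(\<Sum>j<2 * k + 1. a j) = sum a ({..<k} \<union> {k<..2 * k}) + a k"
    by (simp add: sum.union_disjoint del: sum.insert) (subst sum.insert; auto simp: add.commute)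
  also have "sum a ({..<k} \<union> {k<..2 * k}) = sum a {..<k} + sum a {k<..2 * k}"
    by (rule sum.union_disjoint) auto
  also have "sum a {k<..2 * k} = (\<Sum>j<k. a (2 * k - j))"
    by (rule sum.reindex_bij_witness[where i = "\<lambda>j. 2 * k - j" and j = "\<lambda>j. 2 * k - j"]) auto
  finally show ?thesis by (simp add: sum.distrib)
qed

text \<open>Under j -> 2 k - j the theta value changes sign and the phase becomes minus its
  conjugate, so a pair of classes produces twice a cosine; the fixed index j = k drops out by
  \<open>theta_half\<close>.\<close>

lemma theta_inversion:
  fixes y :: real
  assumes y: "0 < y"
  shows "theta (theta_char k i) (of_real ((2 * real k + 1) * y))
    = 2 * (\<Sum>j<k. of_real (cos (pi * (2 * real i + 1) * theta_char k j)) * theta (theta_char k j) (of_real ((2 * real k + 1) / y)))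
        / of_real (sqrt ((2 * real k + 1) * y))"
proof -
  let ?t = "\<lambda>j. theta (theta_char k j) (of_real ((2 * real k + 1) / y))"
  let ?e = "\<lambda>j. exp (of_real (pi * (2 * real i + 1) * theta_char k j) * \<i>)"
  have half: "theta_char k k = 1/2" unfolding theta_char_def by (simp add: field_simps)
  have "?t k = 0" unfolding half using theta_half by simp
  have pair: "?e j * ?t j + ?e (2 * k - j) * ?t (2 * k - j) = 2 * of_real (cos (pi * (2 * real i + 1) * theta_char k j)) * ?t j"
    if "j < k" for j
  proof -
    have refl: "theta_char k (2 * k - j) = 1 - theta_char k j"
      unfolding theta_char_def using that by (simp add: of_nat_diff field_simps)
    have "?t (2 * k - j) = - ?t j" unfolding refl using theta_one_minus[of "theta_char k j"] by simp
    moreover have "?e (2 * k - j) = - exp (- (of_real (pi * (2 * real i + 1) * theta_char k j) * \<i>))"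
    proof -
      have "?e (2 * k - j) = exp (of_real pi * \<i> + - (of_real (pi * (2 * real i + 1) * theta_char k j) * \<i>))"
        unfolding exp_eq refl by (rule exI[of _ "int i"]) (simp add: algebra_simps)
      then show ?thesis by (simp only: exp_add exp_pi_i mult_minus1)
    qed
    moreover have "2 * complex_of_real (cos x) = exp (of_real x * \<i>) + exp (- (of_real x * \<i>))" for x
      by (simp add: cos_of_real[symmetric] cos_exp_eq mult.commute)
    ultimately show ?thesis by (simp add: algebra_simps)
  qed
  have "(\<Sum>j<2 * k + 1. ?e j * ?t j) = (\<Sum>j<k. ?e j * ?t j + ?e (2 * k - j) * ?t (2 * k - j)) + ?e k * ?t k"
    by (rule sum_fold_middle)
  also have "\<dots> = 2 * (\<Sum>j<k. of_real (cos (pi * (2 * real i + 1) * theta_char k j)) * ?t j)"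
    unfolding \<open>?t k = 0\<close> sum_distrib_left using pair by (simp add: mult.assoc)
  finally show ?thesis unfolding theta_inversion_full[OF y] by (simp only:)
qed

text \<open>For the denominator, k = 1 and i = 0, the only coefficient is 2 cos (\<pi> / 6) / sqrt
  (3 y) = 1 / sqrt y, and this cancels the sqrt y in the formula for the numerator.\<close>

lemma theta_inversion_ratio_real:
  fixes y :: real
  assumes y: "0 < y"
  shows "theta (theta_char k i) (of_real ((2 * real k + 1) * y)) * theta (theta_char 1 0) (of_real (3 / y))
    = of_real (2 / sqrt (2 * real k + 1)) * (\<Sum>j<k. of_real (cos (pi * (2 * real i + 1) * theta_char k j))
        * theta (theta_char k j) (of_real ((2 * real k + 1) / y))) * theta (theta_char 1 0) (of_real (3 * y))"
proof -
  have "theta (theta_char 1 0) (of_real (3 * y)) = of_real (2 * (sqrt 3 / 2)) * theta (theta_char 1 0) (of_real (3 / y)) / of_real (sqrt (3 * y))"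
    using theta_inversion[OF y, of 1 0] by (simp add: theta_char_def cos_30)
  also have "\<dots> = theta (theta_char 1 0) (of_real (3 / y)) / of_real (sqrt y)"
    using y by (simp add: real_sqrt_mult)
  finally have "theta (theta_char 1 0) (of_real (3 / y)) = of_real (sqrt y) * theta (theta_char 1 0) (of_real (3 * y))"
    using y by (simp add: field_simps)
  moreover have "complex_of_real (sqrt ((2 * real k + 1) * y)) = of_real (sqrt (2 * real k + 1)) * of_real (sqrt y)"
    by (simp add: real_sqrt_mult)
  moreover have "complex_of_real (sqrt (2 * real k + 1)) \<noteq> 0" "complex_of_real (sqrt y) \<noteq> 0"
    using y by (auto simp: add_eq_0_iff)
  ultimately show ?thesis
    unfolding theta_inversion[OF y] by (simp add: field_simps)
qed

text \<open>In the cross-multiplied form both sides are holomorphic wherever the denominators may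
  vanish. They agree on the positive reals, which accumulate at 1 inside the half plane.\<close>

lemma theta_inversion_ratio:
  assumes v: "0 < Re v"
  shows "theta (theta_char k i) (of_real (2 * real k + 1) * v) * theta (theta_char 1 0) (3 / v)
    = of_real (2 / sqrt (2 * real k + 1)) * (\<Sum>j<k. of_real (cos (pi * (2 * real i + 1) * theta_char k j))
        * theta (theta_char k j) (of_real (2 * real k + 1) / v)) * theta (theta_char 1 0) (3 * v)"
proof -
  let ?H = "{v. 0 < Re v}"
  let ?F = "\<lambda>v. theta (theta_char k i) (of_real (2 * real k + 1) * v) * theta (theta_char 1 0) (3 / v)
    - of_real (2 / sqrt (2 * real k + 1)) * (\<Sum>j<k. of_real (cos (pi * (2 * real i + 1) * theta_char k j))
        * theta (theta_char k j) (of_real (2 * real k + 1) / v)) * theta (theta_char 1 0) (3 * v)"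
  have mul: "(\<lambda>v. theta z (of_real a * v)) holomorphic_on ?H" if "0 < a" for z a
  proof -
    have "theta z \<circ> (\<lambda>v. of_real a * v) holomorphic_on ?H"
      by (rule holomorphic_on_compose_gen[OF _ holomorphic_theta_right]) (use that in \<open>auto intro!: holomorphic_intros\<close>)
    then show ?thesis by (simp add: o_def)
  qed
  have div: "(\<lambda>v. theta z (of_real a / v)) holomorphic_on ?H" if a: "0 < a" for z a
  proof -
    have "0 < Re (of_real a / v)" if "0 < Re v" for v
    proof -
      have "v \<noteq> 0" using that by auto
      then have "0 < (Re v)\<^sup>2 + (Im v)\<^sup>2" using that by (intro add_pos_nonneg) auto
      then show ?thesis using that a by (simp add: Re_divide)
    qed
    then have "theta z \<circ> (\<lambda>v. of_real a / v) holomorphic_on ?H"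
      by (intro holomorphic_on_compose_gen[OF _ holomorphic_theta_right]) (auto intro!: holomorphic_intros)
    then show ?thesis by (simp add: o_def)
  qed
  have K: "0 < 2 * real k + 1" by simp
  have hol: "?F holomorphic_on ?H"
    using mul[of 3] div[of 3] mul[OF K] div[OF K] by (intro holomorphic_intros) auto
  have "?F v = 0"
  proof (rule analytic_continuation[OF hol])
    show "open ?H" by (rule open_halfspace_Re_gt)
    show "connected ?H" by (intro convex_connected convex_halfspace_Re_gt)
    show "of_real ` {0<..} \<subseteq> ?H" by auto
    show "(1::complex) \<in> ?H" by simp
    show "(1::complex) islimpt of_real ` {0<..}"
      unfolding islimpt_sequential
    proof (intro exI conjI allI)
      let ?x = "\<lambda>n::nat. complex_of_real (1 + 1 / real (Suc n))"
      show "?x n \<in> of_real ` {0<..} - {1}" for n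
      proof -
        have "0 < 1 + 1 / real (Suc n)" by (intro add_pos_nonneg) auto
        then have "?x n \<in> of_real ` {0<..}" by (intro imageI) (simp only: greaterThan_iff)
        then show ?thesis by (simp add: complex_eq_iff)
      qed
      have "(\<lambda>n::nat. 1 + 1 / real (Suc n)) \<longlonglongrightarrow> 1" by real_asymp
      from tendsto_of_real[OF this, where 'a = complex] show "?x \<longlonglongrightarrow> 1" by simp
    qed
    show "v \<in> ?H" using v by simp
    show "?F z = 0" if z: "z \<in> of_real ` {0<..}" for z
    proof -
      obtain y where y: "0 < y" "z = of_real y" using z by auto
      show ?thesis unfolding y(2) using theta_inversion_ratio_real[OF y(1), of k i] by simp
    qed
  qed
  then show ?thesis by simp
qed

section \<open>Modular transformations\<close>

lemma qpow_add: "qpow \<tau> (r + s) = qpow \<tau> r * qpow \<tau> s"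
  by (simp add: qpow_def exp_add[symmetric] algebra_simps)

lemma qpow_0 [simp]: "qpow \<tau> 0 = 1"
  by (simp add: qpow_def)

lemma qpow_nonzero: "qpow \<tau> r \<noteq> 0"
  by (simp add: qpow_def)

lemma qpow_power: "qpow \<tau> 1 ^ n = qpow \<tau> (real n)"
  by (induction n) (simp_all add: qpow_add)

lemma norm_qpow_1:
  assumes "0 < Im \<tau>"
  shows "norm (qpow \<tau> 1) < 1"
  using assms by (simp add: qpow_def norm_exp_eq_Re)

lemma qpow_translate: "qpow (\<tau> + of_int m) r = qpow \<tau> r * exp (2 * of_real pi * \<i> * of_real r * of_int m)"
  by (simp add: qpow_def exp_add[symmetric] algebra_simps)

text \<open>Completing the square: \<open>K n\<^sup>2 / 2 + (2 j + 1) n / 2 + (2 j + 1)\<^sup>2 / (8 K)\<close> is half of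
  \<open>K (n + (2 j + 1) / (2 K))\<^sup>2\<close>, where \<open>K = 2 k + 1\<close>.\<close>

lemma qpow_bailey_coeff:
  assumes "j < k"
  shows "qpow \<tau> ((2 * real j + 1)\<^sup>2 / (8 * (2 * real k + 1))) * bailey_coeff (qpow \<tau> 1) (Suc j) (k - j - 1) n
    = theta_term n (theta_char k j) (- \<i> * of_real (2 * real k + 1) * \<tau>)"
proof -
  have nn: "n\<^sup>2 + n \<ge> 0"
    using mult_nonneg_nonneg[of n "n + 1"] mult_nonpos_nonpos[of n "n + 1"]
    by (cases "n \<ge> 0") (auto simp: power2_eq_square algebra_simps)
  have d: "2 * (n * (n - 1) div 2) = n * (n - 1)" by simp
  then have "n * (n - 1) div 2 \<ge> 0"
    using mult_nonneg_nonneg[of n "n - 1"] mult_nonpos_nonpos[of n "n - 1"] by linarith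
  moreover have "2 * real_of_int (n * (n - 1) div 2) = real_of_int (n * (n - 1))"
    using arg_cong[OF d, of real_of_int] by (simp only: of_int_mult of_int_numeral)
  ultimately have 1: "real (nat (n * (n - 1) div 2)) = real_of_int n * (real_of_int n - 1) / 2"
    by simp
  have 2: "real (nat (n\<^sup>2)) = (real_of_int n)\<^sup>2" by simp
  have 3: "real (nat (n\<^sup>2 + n)) = (real_of_int n)\<^sup>2 + real_of_int n" using nn by simp
  have 4: "real (k - j - 1) = real k - real j - 1" using assms by (simp add: of_nat_diff)
  define e where "e = real ((k - j - 1) * nat (n\<^sup>2) + Suc j * nat (n\<^sup>2 + n) + nat (n * (n - 1) div 2))"
  have e: "e = ((2 * real k + 1) * (real_of_int n)\<^sup>2 + (2 * real j + 1) * real_of_int n) / 2"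
    unfolding e_def of_nat_add of_nat_mult 1 2 3 4 by (simp add: power2_eq_square field_simps)
  have square: "t\<^sup>2 / (8 * K) + (K * x\<^sup>2 + t * x) / 2 = K * (x + t / (2 * K))\<^sup>2 / 2" if "K \<noteq> 0" for K t x :: real
    using that by (simp add: power2_eq_square field_simps)
  have "(2 * real j + 1)\<^sup>2 / (8 * (2 * real k + 1)) + e = (2 * real k + 1) * (real_of_int n + theta_char k j)\<^sup>2 / 2"
    unfolding e theta_char_def by (rule square) simp
  then have "qpow \<tau> ((2 * real j + 1)\<^sup>2 / (8 * (2 * real k + 1))) * qpow \<tau> 1 ^ ((k - j - 1) * nat (n\<^sup>2) + Suc j * nat (n\<^sup>2 + n) + nat (n * (n - 1) div 2))
      = qpow \<tau> ((2 * real k + 1) * (real_of_int n + theta_char k j)\<^sup>2 / 2)"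
    unfolding qpow_power e_def[symmetric] by (simp only: qpow_add[symmetric])
  also have "\<dots> = exp (- (of_real pi * (- \<i> * of_real (2 * real k + 1) * \<tau>) * (of_int n + of_real (theta_char k j))\<^sup>2))"
  proof -
    have "2 * of_real pi * \<i> * of_real (a * b\<^sup>2 / 2) * \<tau> = - (of_real pi * (- \<i> * of_real a * \<tau>) * (of_real b)\<^sup>2)" for a b
      by simp
    then show ?thesis unfolding qpow_def by (simp only: of_real_add of_real_of_int_eq)
  qed
  finally show ?thesis
    unfolding bailey_coeff_def theta_term_def by (simp only: mult.left_commute)
qed

text \<open>Entry j belongs to the series with i = k - j, hence to j + 1 steps relative to q and k -
  j - 1 steps relative to 1.\<close>

lemma qpow_AG_series:
  assumes \<tau>: "0 < Im \<tau>" and j: "j < k"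
    and L: "(\<lambda>n. inv_qpoch (qpow \<tau> 1) (int n)) \<longlonglongrightarrow> L"
  shows "qpow \<tau> ((2 * real j + 1)\<^sup>2 / (8 * (2 * real k + 1))) * AG_series k (k - j) (qpow \<tau> 1)
    = L * theta (theta_char k j) (- \<i> * of_real (2 * real k + 1) * \<tau>)"
proof -
  let ?q = "qpow \<tau> 1" and ?p = "qpow \<tau> ((2 * real j + 1)\<^sup>2 / (8 * (2 * real k + 1)))"
  have q: "norm ?q < 1" "?q \<noteq> 0" using norm_qpow_1[OF \<tau>] qpow_nonzero by auto
  have kj: "k - (k - j) = j" using j by simp
  have "AG_series k (k - j) ?q = L * (\<Sum>\<^sub>\<infinity>n. bailey_coeff ?q (Suc j) (k - j - 1) n)"
    using AG_series_eq_bilateral[OF q _ _ L, of "k - j" k] j unfolding kj by simp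
  then have "?p * AG_series k (k - j) ?q = L * (?p * (\<Sum>\<^sub>\<infinity>n. bailey_coeff ?q (Suc j) (k - j - 1) n))"
    by (simp only: mult.left_commute)
  also have "?p * (\<Sum>\<^sub>\<infinity>n. bailey_coeff ?q (Suc j) (k - j - 1) n) = (\<Sum>\<^sub>\<infinity>n. ?p * bailey_coeff ?q (Suc j) (k - j - 1) n)"
    by (rule infsum_cmult_right[symmetric]) (rule bailey_coeff_summable[OF q(1)], simp)
  also have "\<dots> = theta (theta_char k j) (- \<i> * of_real (2 * real k + 1) * \<tau>)"
    unfolding theta_def qpow_bailey_coeff[OF j] ..
  finally show ?thesis .
qed

lemma AG_series_1: "AG_series 1 1 q = 1"
  by (simp add: AG_series_def)

text \<open>The case \<open>k = 1\<close> of the Andrews--Gordon identity is Euler's pentagonal number theorem: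
  it identifies \<open>q\<^bsup>1/24\<^esup> (q; q)\<^sub>\<infinity>\<close> with a theta series of the same kind.\<close>

lemma AG_theta_quotient:
  assumes \<tau>: "0 < Im \<tau>" and j: "j < k"
  shows "qpow \<tau> (- 1 / 24) * (qpow \<tau> ((2 * real j + 1)\<^sup>2 / (8 * (2 * real k + 1))) * AG_series k (k - j) (qpow \<tau> 1))
    = theta (theta_char k j) (- \<i> * of_real (2 * real k + 1) * \<tau>) / theta (theta_char 1 0) (- \<i> * 3 * \<tau>)"
    and "theta (theta_char 1 0) (- \<i> * 3 * \<tau>) \<noteq> 0"
proof -
  obtain L where L: "(\<lambda>n. inv_qpoch (qpow \<tau> 1) (int n)) \<longlonglongrightarrow> L"
    using inv_qpoch_limit[OF norm_qpow_1[OF \<tau>]] by blast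
  \<comment> \<open>For k = 1 and j = 0 the series is 1 and the exponent of the prefactor is 1 / (8
    * 3) = 1 / 24.\<close>
  have eta: "qpow \<tau> (1 / 24) = L * theta (theta_char 1 0) (- \<i> * 3 * \<tau>)"
    using qpow_AG_series[OF \<tau> _ L, of 0 1] by (simp add: AG_series_1[unfolded One_nat_def] mult_ac)
  then show nz: "theta (theta_char 1 0) (- \<i> * 3 * \<tau>) \<noteq> 0"
    using qpow_nonzero[of \<tau> "1 / 24"] by auto
  have "qpow \<tau> (- 1 / 24) * qpow \<tau> (1 / 24) = 1"
    by (simp add: qpow_add[symmetric])
  then have "qpow \<tau> (- 1 / 24) * L * theta (theta_char 1 0) (- \<i> * 3 * \<tau>) = 1"
    unfolding eta by (simp add: mult.assoc)
  then have "qpow \<tau> (- 1 / 24) * L = 1 / theta (theta_char 1 0) (- \<i> * 3 * \<tau>)"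
    using nz by (simp only: nonzero_eq_divide_eq not_False_eq_True)
  then show "qpow \<tau> (- 1 / 24) * (qpow \<tau> ((2 * real j + 1)\<^sup>2 / (8 * (2 * real k + 1))) * AG_series k (k - j) (qpow \<tau> 1))
    = theta (theta_char k j) (- \<i> * of_real (2 * real k + 1) * \<tau>) / theta (theta_char 1 0) (- \<i> * 3 * \<tau>)"
    unfolding qpow_AG_series[OF \<tau> j L] mult.assoc[symmetric] by simp
qed

lemma AG_vec_carrier: "AG_vec k \<tau> \<in> carrier_vec k"
  by (simp add: AG_vec_def)

lemma AG_vec_index:
  assumes "j < k"
  shows "AG_vec k \<tau> $ j = qpow \<tau> (- 1 / 24) * (qpow \<tau> ((2 * real j + 1)\<^sup>2 / (8 * (2 * real k + 1))) * AG_series k (k - j) (qpow \<tau> 1))"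
  using assms by (simp add: AG_vec_def)

lemma mat_diag_mult_vec_index:
  assumes "v \<in> carrier_vec k" "i < k"
  shows "((c \<cdot>\<^sub>m mat_diag k f) *\<^sub>v v) $ i = c * f i * (v $ i :: complex)"
proof -
  have "((c \<cdot>\<^sub>m mat_diag k f) *\<^sub>v v) $ i = (\<Sum>j\<in>{0..<k}. (c * (if i = j then f j else 0)) * v $ j)"
    using assms by (simp add: scalar_prod_def mat_diag_def)
  also have "\<dots> = (\<Sum>j\<in>{0..<k}. if i = j then c * f j * v $ j else 0)"
    by (rule sum.cong) auto
  finally show ?thesis using assms by simp
qed

text \<open>Stated for every integer m because the quotients in Euclid's algorithm are arbitrary and
  may be negative. The series depend on q alone, so only the fractional powers produce
  factors.\<close>

lemma AG_vec_translate:
  "AG_vec k (\<tau> + of_int m) =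
     (exp (- (1 / 12) * of_real pi * \<i> * of_int m) \<cdot>\<^sub>m
        mat_diag k (\<lambda>j. exp (of_real ((2 * real j + 1)\<^sup>2 / (4 * (2 * real k + 1))) * of_real pi * \<i> * of_int m))) *\<^sub>v AG_vec k \<tau>"
    (is "?l = ?M *\<^sub>v _")
proof (rule eq_vecI)
  show "dim_vec ?l = dim_vec (?M *\<^sub>v AG_vec k \<tau>)" by (simp add: AG_vec_def mat_diag_def)
  fix i assume "i < dim_vec (?M *\<^sub>v AG_vec k \<tau>)"
  then have i: "i < k" by (simp add: mat_diag_def)
  have "qpow (\<tau> + of_int m) 1 = qpow \<tau> 1"
    unfolding qpow_translate using exp_integer_2pi[of "of_int m"] by (simp add: mult_ac)
  moreover have "exp (2 * of_real pi * \<i> * of_real (- 1 / 24) * of_int m) = exp (- (1 / 12) * of_real pi * \<i> * of_int m)"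
    by (simp add: mult_ac)
  moreover have "2 * of_real pi * \<i> * of_real ((2 * real i + 1)\<^sup>2 / (8 * (2 * real k + 1))) * of_int m
      = of_real ((2 * real i + 1)\<^sup>2 / (4 * (2 * real k + 1))) * of_real pi * \<i> * of_int m"
  proof -
    have "a / (4 * b) = 2 * (a / (8 * b))" for a b :: real
      by (cases "b = 0") (auto simp: field_simps)
    then have "(2 * real i + 1)\<^sup>2 / (4 * (2 * real k + 1)) = 2 * ((2 * real i + 1)\<^sup>2 / (8 * (2 * real k + 1)))" .
    then show ?thesis by (simp only: of_real_mult of_real_numeral mult_ac)
  qed
  ultimately show "?l $ i = (?M *\<^sub>v AG_vec k \<tau>) $ i"
    unfolding mat_diag_mult_vec_index[OF AG_vec_carrier i] AG_vec_index[OF i] qpow_translate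
    by (simp only: mult_ac)
qed

lemma AG_vec_inversion:
  assumes \<tau>: "0 < Im \<tau>"
  shows "AG_vec k (- 1 / \<tau>) = (complex_of_real (2 / sqrt (2 * real k + 1)) \<cdot>\<^sub>m AG_cos_mat k) *\<^sub>v AG_vec k \<tau>"
    (is "?l = ?M *\<^sub>v _")
proof (rule eq_vecI)
  show "dim_vec ?l = dim_vec (?M *\<^sub>v AG_vec k \<tau>)" by (simp add: AG_vec_def AG_cos_mat_def)
  fix i assume "i < dim_vec (?M *\<^sub>v AG_vec k \<tau>)"
  then have i: "i < k" by (simp add: AG_cos_mat_def)
  have nz: "\<tau> \<noteq> 0" using \<tau> by auto
  have \<tau>': "0 < Im (- 1 / \<tau>)"
    using \<tau> nz by (simp add: Im_divide sum_power2_gt_zero_iff complex_eq_iff)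
  \<comment> \<open>With K = 2 k + 1 the theta argument is K v at -1/\<tau> and K / v at \<tau>, so
    inverting \<tau> amounts to inverting \<open>v\<close>.\<close>
  define v where "v = \<i> / \<tau>"
  have v: "0 < Re v"
    using \<tau> nz by (simp add: v_def Re_divide sum_power2_gt_zero_iff complex_eq_iff)
  have args: "- \<i> * a * (- 1 / \<tau>) = a * v" "- \<i> * a * \<tau> = a / v" for a
    using nz by (simp_all add: v_def field_simps)
  let ?t0 = "theta (theta_char 1 0)"
  have e: "AG_vec k (- 1 / \<tau>) $ i = theta (theta_char k i) (of_real (2 * real k + 1) * v) / ?t0 (3 * v)" "?t0 (3 * v) \<noteq> 0"
    unfolding AG_vec_index[OF i] using AG_theta_quotient[OF \<tau>' i] unfolding args by blast+
  have f: "AG_vec k \<tau> $ j = theta (theta_char k j) (of_real (2 * real k + 1) / v) / ?t0 (3 / v)" if "j < k" for j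
    unfolding AG_vec_index[OF that] using AG_theta_quotient(1)[OF \<tau> that] unfolding args .
  have g: "?t0 (3 / v) \<noteq> 0"
    using AG_theta_quotient(2)[OF \<tau> i] unfolding args .
  let ?c = "complex_of_real (2 / sqrt (2 * real k + 1))"
  let ?cos = "\<lambda>j. complex_of_real (cos ((2 * real i + 1) * (2 * real j + 1) * pi / (2 * (2 * real k + 1))))"
  have cos: "pi * (2 * real i + 1) * theta_char k j = (2 * real i + 1) * (2 * real j + 1) * pi / (2 * (2 * real k + 1))" for j
    by (simp add: theta_char_def)
  have "(?M *\<^sub>v AG_vec k \<tau>) $ i = (\<Sum>j<k. ?c * ?cos j * AG_vec k \<tau> $ j)"
    using i AG_vec_carrier[of k \<tau>] by (auto simp: AG_cos_mat_def scalar_prod_def lessThan_atLeast0 intro!: sum.cong)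
  also have "\<dots> = ?c * (\<Sum>j<k. ?cos j * theta (theta_char k j) (of_real (2 * real k + 1) / v)) / ?t0 (3 / v)"
    unfolding sum_distrib_left sum_divide_distrib by (rule sum.cong) (simp_all add: f)
  also have "\<dots> = AG_vec k (- 1 / \<tau>) $ i"
    unfolding e(1) frac_eq_eq[OF g e(2)] using theta_inversion_ratio[OF v, of k i] unfolding cos by (rule sym)
  finally show "?l $ i = (?M *\<^sub>v AG_vec k \<tau>) $ i" ..
qed

section \<open>From the two generators to the modular group\<close>

lemma Im_moebius_pos:
  fixes a b c d :: int
  assumes \<tau>: "0 < Im \<tau>" and det: "a * d - b * c = 1"
  shows "of_int c * \<tau> + of_int d \<noteq> 0" and "0 < Im ((of_int a * \<tau> + of_int b) / (of_int c * \<tau> + of_int d))"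
proof -
  show nz: "of_int c * \<tau> + of_int d \<noteq> 0"
  proof
    assume z: "of_int c * \<tau> + of_int d = 0"
    then have "Im (of_int c * \<tau> + of_int d) = 0" by (simp only: zero_complex.simps)
    then have "c = 0" using \<tau> by simp
    moreover from this have "d = 0" using z by simp
    ultimately show False using det by simp
  qed
  let ?D = "(Re (of_int c * \<tau> + of_int d))\<^sup>2 + (Im (of_int c * \<tau> + of_int d))\<^sup>2"
  have D: "0 < ?D" using nz by (simp only: sum_power2_gt_zero_iff complex_eq_iff zero_complex.simps) blast
  have "Im ((of_int a * \<tau> + of_int b) / (of_int c * \<tau> + of_int d)) = real_of_int (a * d - b * c) * Im \<tau> / ?D"
    unfolding Im_divide by (rule arg_cong2[of _ _ _ _ "(/)"]) (simp_all add: algebra_simps)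
  then show "0 < Im ((of_int a * \<tau> + of_int b) / (of_int c * \<tau> + of_int d))"
    unfolding det using \<tau> D by simp
qed

text \<open>Euclid's algorithm on the first column writes every element of the modular group as a word in the
  translations and the inversion.\<close>

lemma vector_valued_moebius:
  fixes X :: "complex \<Rightarrow> complex Matrix.vec"
  assumes X: "\<And>\<tau>. 0 < Im \<tau> \<Longrightarrow> X \<tau> \<in> carrier_vec k"
    and T: "\<And>m::int. \<exists>M\<in>carrier_mat k k. \<forall>\<tau>. 0 < Im \<tau> \<longrightarrow> X (\<tau> + of_int m) = M *\<^sub>v X \<tau>"
    and S: "\<exists>M\<in>carrier_mat k k. \<forall>\<tau>. 0 < Im \<tau> \<longrightarrow> X (- 1 / \<tau>) = M *\<^sub>v X \<tau>"
    and det: "a * d - b * c = 1"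
  shows "\<exists>M\<in>carrier_mat k k. \<forall>\<tau>. 0 < Im \<tau> \<longrightarrow>
           X ((of_int a * \<tau> + of_int b) / (of_int c * \<tau> + of_int d)) = M *\<^sub>v X \<tau>"
  using det
proof (induction "nat \<bar>c\<bar>" arbitrary: a b c d rule: less_induct)
  case less
  show ?case
  proof (cases "c = 0")
    case True
    then have "a * d = 1" using less.prems by simp
    then have "a = 1 \<and> d = 1 \<or> a = -1 \<and> d = -1" by (simp add: zmult_eq_1_iff)
    \<comment> \<open>Here a = d is 1 or -1, so the map is the translation by b / d = a b.\<close>
    then have eq: "(of_int a * \<tau> + of_int b) / (of_int c * \<tau> + of_int d) = \<tau> + of_int (a * b)" for \<tau> :: complex
      using True by (elim disjE conjE) simp_all
    show ?thesis unfolding eq by (rule T)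
  next
    case False
    \<comment> \<open>As a Moebius map, the matrix with rows (a, b), (c, d) is translation by
      \<open>m\<close> after inversion after the matrix with rows (-c, -d), (a', b'), whose lower
      left entry is the smaller remainder.\<close>
    define m a' b' where "m = a div c" and "a' = a mod c" and "b' = b - m * d"
    have a': "a = m * c + a'" by (simp add: m_def a'_def)
    have lt: "nat \<bar>a'\<bar> < nat \<bar>c\<bar>" unfolding a'_def using abs_mod_less[OF False, of a] by simp
    have det': "(- c) * b' - (- d) * a' = 1"
    proof -
      have "(- c) * b' - (- d) * a' = (m * c + a') * d - b * c" unfolding b'_def by (simp add: algebra_simps)
      then show ?thesis unfolding a'[symmetric] less.prems .
    qed
    from less.hyps[OF lt det'] obtain M where M: "M \<in> carrier_mat k k" "\<And>\<tau>. 0 < Im \<tau> \<Longrightarrow>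
        X ((of_int (- c) * \<tau> + of_int (- d)) / (of_int a' * \<tau> + of_int b')) = M *\<^sub>v X \<tau>"
      by (elim bexE) blast
    obtain Mt where Mt: "Mt \<in> carrier_mat k k" "\<And>\<tau>. 0 < Im \<tau> \<Longrightarrow> X (\<tau> + of_int m) = Mt *\<^sub>v X \<tau>"
      using T[of m] by blast
    obtain Ms where Ms: "Ms \<in> carrier_mat k k" "\<And>\<tau>. 0 < Im \<tau> \<Longrightarrow> X (- 1 / \<tau>) = Ms *\<^sub>v X \<tau>"
      using S by blast
    have "X ((of_int a * \<tau> + of_int b) / (of_int c * \<tau> + of_int d)) = (Mt * (Ms * M)) *\<^sub>v X \<tau>"
      if \<tau>: "0 < Im \<tau>" for \<tau>
    proof -
      define \<sigma> where "\<sigma> = (of_int (- c) * \<tau> + of_int (- d)) / (of_int a' * \<tau> + of_int b')"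
      have \<sigma>: "0 < Im \<sigma>" "of_int a' * \<tau> + of_int b' \<noteq> 0"
        unfolding \<sigma>_def using Im_moebius_pos[OF \<tau> det'] by blast+
      have cd: "of_int c * \<tau> + of_int d \<noteq> 0"
        by (rule Im_moebius_pos(1)[OF \<tau> less.prems])
      have "- 1 / \<sigma> = (of_int a' * \<tau> + of_int b') / (of_int c * \<tau> + of_int d)"
      proof -
        have "of_int (- c) * \<tau> + of_int (- d) = - (of_int c * \<tau> + of_int d)" by simp
        moreover have "- 1 / (- u / t) = t / u" for u t :: complex by simp
        ultimately show ?thesis unfolding \<sigma>_def by (simp only:)
      qed
      moreover have "of_int a * \<tau> + of_int b = (of_int a' * \<tau> + of_int b') + of_int m * (of_int c * \<tau> + of_int d)"
        unfolding b'_def by (subst a') (simp add: algebra_simps)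
      ultimately have "(of_int a * \<tau> + of_int b) / (of_int c * \<tau> + of_int d) = - 1 / \<sigma> + of_int m"
        by (simp only: add_divide_distrib nonzero_mult_div_cancel_right[OF cd])
      moreover have "0 < Im (- 1 / \<sigma>)"
        using Im_moebius_pos(2)[of \<sigma> 0 0 "-1" 1] \<sigma>(1) by simp
      ultimately have "X ((of_int a * \<tau> + of_int b) / (of_int c * \<tau> + of_int d)) = Mt *\<^sub>v (Ms *\<^sub>v X \<sigma>)"
        by (simp only: Mt(2) Ms(2)[OF \<sigma>(1)])
      also have "X \<sigma> = M *\<^sub>v X \<tau>" unfolding \<sigma>_def by (rule M(2)[OF \<tau>])
      also have "Mt *\<^sub>v (Ms *\<^sub>v (M *\<^sub>v X \<tau>)) = (Mt * (Ms * M)) *\<^sub>v X \<tau>"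
        by (simp only: assoc_mult_mat_vec[OF Ms(1) M(1) X[OF \<tau>]]
            assoc_mult_mat_vec[OF Mt(1) mult_carrier_mat[OF Ms(1) M(1)] X[OF \<tau>]])
      finally show ?thesis .
    qed
    moreover have "Mt * (Ms * M) \<in> carrier_mat k k" using Mt(1) Ms(1) M(1) by simp
    ultimately show ?thesis by blast
  qed
qed

lemma det_carrier_mat_2:
  fixes A :: "'a :: comm_ring_1 Matrix.mat"
  assumes A: "A \<in> carrier_mat 2 2"
  shows "Determinant.det A = A $$ (0, 0) * A $$ (1, 1) - A $$ (0, 1) * A $$ (1, 0)"
proof -
  have d: "Determinant.det (mat_delete A 0 j) = mat_delete A 0 j $$ (0, 0)" for j
    using mat_delete_carrier[OF A] by (intro det_single) simp
  have e: "mat_delete A 0 0 $$ (0, 0) = A $$ (1, 1)" "mat_delete A 0 1 $$ (0, 0) = A $$ (1, 0)"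
    using A by (simp_all add: mat_delete_def)
  have "Determinant.det A = (\<Sum>j<2. A $$ (0, j) * cofactor A 0 j)"
    by (rule laplace_expansion_row[OF A]) simp
  also have "\<dots> = A $$ (0, 0) * cofactor A 0 0 + A $$ (0, 1) * cofactor A 0 1"
    by (simp add: numeral_2_eq_2)
  finally show ?thesis unfolding cofactor_def d e by simp
qed

lemma vv_modular_function_SL2Z:
  fixes X :: "complex \<Rightarrow> complex Matrix.vec"
  assumes X: "\<And>\<tau>. 0 < Im \<tau> \<Longrightarrow> X \<tau> \<in> carrier_vec k"
    and T: "\<And>m::int. \<exists>M\<in>carrier_mat k k. \<forall>\<tau>. 0 < Im \<tau> \<longrightarrow> X (\<tau> + of_int m) = M *\<^sub>v X \<tau>"
    and S: "\<exists>M\<in>carrier_mat k k. \<forall>\<tau>. 0 < Im \<tau> \<longrightarrow> X (- 1 / \<tau>) = M *\<^sub>v X \<tau>"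
  shows "vv_modular_function k (carrier SL2Z) X"
  unfolding vv_modular_function_def
proof (intro conjI allI impI ballI)
  show "subgroup (carrier SL2Z) SL2Z" using group.subgroup_self[OF group_SL2Z] .
  show "X \<tau> \<in> carrier_vec k" if "0 < Im \<tau>" for \<tau> by (rule X[OF that])
  fix A assume "A \<in> carrier SL2Z"
  then have A: "A \<in> carrier_mat 2 2" "Determinant.det A = 1" by (auto simp: SL2Z_def)
  have "A $$ (0, 0) * A $$ (1, 1) - A $$ (0, 1) * A $$ (1, 0) = 1"
    using det_carrier_mat_2[OF A(1)] A(2) by simp
  from vector_valued_moebius[of X k, OF X T S this]
  show "\<exists>\<rho>\<in>carrier_mat k k. \<forall>\<tau>. 0 < Im \<tau> \<longrightarrow> X (moebius_act A \<tau>) = \<rho> *\<^sub>v X \<tau>"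
    unfolding moebius_act_def by simp
qed

theorem corollary1p5:
  fixes k :: nat
  assumes "k \<ge> 2"
  shows
    "(\<forall>\<tau>. Im \<tau> > 0 \<longrightarrow>
        AG_vec k (\<tau> + 1) =
          (exp (- (1 / 12) * of_real pi * \<i>) \<cdot>\<^sub>m
             mat_diag k (\<lambda>j. exp (of_real ((2 * real j + 1)\<^sup>2 / (4 * (2 * real k + 1))) * of_real pi * \<i>)))
          *\<^sub>v AG_vec k \<tau>) \<and>
     (\<forall>\<tau>. Im \<tau> > 0 \<longrightarrow>
        AG_vec k (- 1 / \<tau>) =
          (complex_of_real (2 / sqrt (2 * real k + 1)) \<cdot>\<^sub>m AG_cos_mat k) *\<^sub>v AG_vec k \<tau>) \<and>
     vv_modular_function k (carrier SL2Z) (AG_vec k)"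
proof (intro conjI allI impI)
  show "AG_vec k (\<tau> + 1) =
          (exp (- (1 / 12) * of_real pi * \<i>) \<cdot>\<^sub>m
             mat_diag k (\<lambda>j. exp (of_real ((2 * real j + 1)\<^sup>2 / (4 * (2 * real k + 1))) * of_real pi * \<i>)))
          *\<^sub>v AG_vec k \<tau>" for \<tau>
    using AG_vec_translate[of k \<tau> 1] by (simp only: of_int_1 mult_1_right)
  show "AG_vec k (- 1 / \<tau>) =
          (complex_of_real (2 / sqrt (2 * real k + 1)) \<cdot>\<^sub>m AG_cos_mat k) *\<^sub>v AG_vec k \<tau>" if "Im \<tau> > 0" for \<tau>
    by (rule AG_vec_inversion[OF that])
  show "vv_modular_function k (carrier SL2Z) (AG_vec k)"
  proof (rule vv_modular_function_SL2Z)
    show "\<exists>M\<in>carrier_mat k k. \<forall>\<tau>. 0 < Im \<tau> \<longrightarrow> AG_vec k (\<tau> + of_int m) = M *\<^sub>v AG_vec k \<tau>" for m :: int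
    proof (intro bexI allI impI)
      show "AG_vec k (\<tau> + of_int m) =
          (exp (- (1 / 12) * of_real pi * \<i> * of_int m) \<cdot>\<^sub>m
            mat_diag k (\<lambda>j. exp (of_real ((2 * real j + 1)\<^sup>2 / (4 * (2 * real k + 1))) * of_real pi * \<i> * of_int m)))
          *\<^sub>v AG_vec k \<tau>" for \<tau>
        by (rule AG_vec_translate)
    qed simp
    show "\<exists>M\<in>carrier_mat k k. \<forall>\<tau>. 0 < Im \<tau> \<longrightarrow> AG_vec k (- 1 / \<tau>) = M *\<^sub>v AG_vec k \<tau>"
    proof (intro bexI allI impI)
      show "AG_vec k (- 1 / \<tau>) = (complex_of_real (2 / sqrt (2 * real k + 1)) \<cdot>\<^sub>m AG_cos_mat k) *\<^sub>v AG_vec k \<tau>"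
        if "0 < Im \<tau>" for \<tau>
        by (rule AG_vec_inversion[OF that])
    qed (simp add: AG_cos_mat_def)
  qed (rule AG_vec_carrier)
qed

end
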